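(* Let $0<l<n$, $0\le\lambda<\infty$, $0<p_1\le p_2\le\infty$, $\vec q_1=(q_{11},\dots,q_{1n})$ with $1<q_{1i}<\frac1l$ for all $i$, $\vec q_2=(q_{21},\dots,q_{2n})\in[1,\infty)^n$, $$l=\sum_{i=1}^n\frac1{q_{1i}}-\sum_{i=1}^n\frac1{q_{2i}},\qquad \lambda-\sum_{i=1}^n\frac1{q_{2i}}<\alpha<n-\sum_{i=1}^n\frac1{q_{1i}}.$$ Suppose a sublinear operator $I_l$ satisfies: (1) $I_l$ is bounded from $L^{\vec q_1}(\mathbb R^n)$ to $L^{\vec q_2}(\mathbb R^n)$; (2) there is a constant $C$ such that for every $j\in\mathbb Z$ and every $f\in L^1(\mathbb R^n)$ with $\operatorname{supp} f\subset A_j$, $|I_lf(x)|\le C\,\|f\|_{L^1}\,|x|^{-(n-l)}$ whenever $|x|\ge2^{j+1}$; (3) there is a constant $C$ such that for every $j\in\mathbb Z$ and every $f\in L^1(\mathbb R^n)$ with $\operatorname{supp} f\subset A_j$, $|I_lf(x)|\le C\,\|f\|_{L^1}\,2^{-j(n-l)}$ whenever $|x|\le2^{j-2}$. Then $I_l$ is bounded from $M\dot K^{\alpha,\lambda}_{p_1,\vec q_1}(\mathbb R^n)$ to $M\dot K^{\alpha,\lambda}_{p_2,\vec q_2}(\mathbb R^n)$, i.e. there is a constant $C$ with $\|I_lf\|_{M\dot K^{\alpha,\lambda}_{p_2,\vec q_2}}\le C\|f\|_{M\dot K^{\alpha,\lambda}_{p_1,\vec q_1}}$ for all $f\in M\dot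 K^{\alpha,\lambda}_{p_1,\vec q_1}(\mathbb R^n)$.
   Context: For $k\in\mathbb Z$: $B_k=\{x\in\mathbb R^n:|x|\le 2^k\}$, $A_k=B_k\setminus B_{k-1}$, $\chi_k=\chi_{A_k}$ (characteristic function). "$\operatorname{supp} f\subset A_k$" means $f$ vanishes a.e. outside $A_k$. Mixed Lebesgue space: for $\vec q=(q_1,\dots,q_n)\in(0,\infty)^n$, $L^{\vec q}(\mathbb R^n)$ is the set of measurable $f$ with $$\|f\|_{L^{\vec q}}=\Big(\int_{\mathbb R}\cdots\Big(\int_{\mathbb R}\Big(\int_{\mathbb R}|f(x_1,\dots,x_n)|^{q_1}dx_1\Big)^{q_2/q_1}dx_2\Big)^{q_3/q_2}\cdots dx_n\Big)^{1/q_n}<\infty.$$ Homogeneous mixed Herz-Morrey space: for $\alpha\in\mathbb R$, $0<p\le\infty$, $0\le\lambda<\infty$, $\vec q\in[1,\infty)^n$, $M\dot K^{\alpha,\lambda}_{p,\vec q}(\mathbb R^n)$ is the set of $f\in L^{\vec q}_{loc}(\mathbb R^n\setminus\{0\})$ with $$\|f\|_{M\dot K^{\alpha,\lambda}_{p,\vec q}}=\sup_{k_0\in\mathbb Z}2^{-k_0\lambda}\Big\{\sum_{k=-\infty}^{k_0}2^{k\alpha p}\|f\chi_k\|_{L^{\vec q}}^p\Big\}^{1/p}<\infty,$$ where for $p=\infty$ the expression $\{\cdot\}^{1/p}$ is replaced by $\sup_{k\le k_0}2^{k\alpha}\|f\chi_k\|_{L^{\vec q}}$. A sublinear operator $T$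 maps functions on $\mathbb R^n$ to measurable functions and satisfies $|T(f+g)|\le|Tf|+|Tg|$ and $|T(cf)|=|c||Tf|$ for scalars $c$; its domain is understood to contain all the functions to which it is applied.
   Formalization: Two-term sublinearity does not suffice (linear counterexamples exist), so it is also assumed that, for every f in the source Herz-Morrey space, |I_l f| is at most the sum over all integers j of |I_l(f χ_j)| almost everywhere. *)

theory Defs
  imports "HOL-Analysis.Analysis"
begin

text \<open>
  Euclidean space is \<open>real ^ 'n\<close>. Iterated integrals with different exponents depend on the order
  of the coordinates, so the index type \<open>'n\<close> is a finite linear order. Functions take values in a
  type of class \<open>real_normed_field\<close> and \<open>euclidean_space\<close>, which covers the real and the complex
  numbers. Measurable means Lebesgue measurable, functions are not identified modulo null sets,
  and all norms are \<open>ennreal\<close>-valued, so that they are defined for every function.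
\<close>

definition epowr :: "ennreal \<Rightarrow> real \<Rightarrow> ennreal" where
  "epowr x a = (if x = \<infinity> then \<infinity> else ennreal (enn2real x powr a))"  \<comment> \<open>only used for \<open>a > 0\<close>\<close>


subsection \<open>Mixed Lebesgue spaces\<close>

definition upd_coord :: "real ^ 'n \<Rightarrow> 'n \<Rightarrow> real \<Rightarrow> real ^ 'n" where
  "upd_coord x i t = (\<chi> j. if j = i then t else x $ j)"

text \<open>
  The list contains the coordinates still to be integrated out, and \<open>r\<close> is the exponent of the
  previous coordinate (1 at the start). For the list \<open>[1, \<dots>, n]\<close> and \<open>r = 1\<close> this is
  \<open>(\<integral> \<dots> (\<integral> (\<integral> F\<^sup>q\<^sup>1 dx\<^sub>1)\<^sup>q\<^sup>2\<^sup>/\<^sup>q\<^sup>1 dx\<^sub>2)\<^sup>q\<^sup>3\<^sup>/\<^sup>q\<^sup>2 \<dots> dx\<^sub>n)\<^sup>1\<^sup>/\<^sup>q\<^sup>n\<close>.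
\<close>

fun mixed_iter ::
  "real ^ 'n \<Rightarrow> real \<Rightarrow> 'n list \<Rightarrow> (real ^ 'n \<Rightarrow> ennreal) \<Rightarrow> real ^ 'n \<Rightarrow> ennreal" where
  "mixed_iter q r [] F x = epowr (F x) (1 / r)"
| "mixed_iter q r (i # is) F x =
     mixed_iter q (q $ i) is (\<lambda>y. \<integral>\<^sup>+ t. epowr (F (upd_coord y i t)) (q $ i / r) \<partial>lebesgue) x"

text \<open>All coordinates are integrated out, so the evaluation point \<open>0\<close> is immaterial.\<close>

definition mixed_norm ::
  "real ^ 'n::{finite,linorder} \<Rightarrow> (real ^ 'n::{finite,linorder} \<Rightarrow> 'a::real_normed_vector) \<Rightarrow> ennreal" where
  "mixed_norm q f = mixed_iter q 1 (sorted_list_of_set UNIV) (\<lambda>x. ennreal (norm (f x))) 0"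

definition mixed_lebesgue ::
  "real ^ 'n::{finite,linorder} \<Rightarrow> (real ^ 'n::{finite,linorder} \<Rightarrow> 'a::real_normed_vector) set" where
  "mixed_lebesgue q = {f \<in> borel_measurable lebesgue. mixed_norm q f < \<infinity>}"

definition restr :: "'b set \<Rightarrow> ('b \<Rightarrow> 'a::real_vector) \<Rightarrow> 'b \<Rightarrow> 'a" where
  "restr A f = (\<lambda>x. indicat_real A x *\<^sub>R f x)"

definition mixed_lebesgue_loc_punctured ::
  "real ^ 'n::{finite,linorder} \<Rightarrow> (real ^ 'n::{finite,linorder} \<Rightarrow> 'a::real_normed_vector) set" where
  "mixed_lebesgue_loc_punctured q =
     {f \<in> borel_measurable lebesgue.
        \<forall>K. compact K \<and> K \<subseteq> UNIV - {0} \<longrightarrow> restr K f \<in> mixed_lebesgue q}"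


subsection \<open>Homogeneous mixed Herz-Morrey spaces\<close>

definition dyadic_ball :: "int \<Rightarrow> (real ^ 'n) set" where
  "dyadic_ball k = {x. norm x \<le> 2 powr real_of_int k}"

definition annulus :: "int \<Rightarrow> (real ^ 'n) set" where
  "annulus k = dyadic_ball k - dyadic_ball (k - 1)"

definition herz_morrey_norm ::
  "real \<Rightarrow> real \<Rightarrow> ennreal \<Rightarrow> real ^ 'n::{finite,linorder}
     \<Rightarrow> (real ^ 'n::{finite,linorder} \<Rightarrow> 'a::real_normed_vector) \<Rightarrow> ennreal" where
  "herz_morrey_norm \<alpha> lam p q f =
     (SUP k0 :: int. ennreal (2 powr (- real_of_int k0 * lam)) *
        (if p = \<infinity>
         then (SUP k \<in> {..k0}. ennreal (2 powr (real_of_int k * \<alpha>)) * mixed_norm q (restr (annulus k) f))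
         else epowr
                (\<Sum>\<^sub>\<infinity> k \<in> {..k0}. ennreal (2 powr (real_of_int k * \<alpha> * enn2real p)) *
                   epowr (mixed_norm q (restr (annulus k) f)) (enn2real p))
                (1 / enn2real p)))"

definition herz_morrey ::
  "real \<Rightarrow> real \<Rightarrow> ennreal \<Rightarrow> real ^ 'n::{finite,linorder}
     \<Rightarrow> (real ^ 'n::{finite,linorder} \<Rightarrow> 'a::real_normed_vector) set" where
  "herz_morrey \<alpha> lam p q =
     {f \<in> mixed_lebesgue_loc_punctured q. herz_morrey_norm \<alpha> lam p q f < \<infinity>}"


subsection \<open>Operators\<close>

text \<open>\<open>L\<^sup>1\<close> functions with support in \<open>A\<close>, in the almost everywhere sense.\<close>

definition L1_supported_in ::
  "(real ^ 'n) set \<Rightarrow> (real ^ 'n \<Rightarrow> 'a::{banach,second_countable_topology}) set" where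
  "L1_supported_in A = {f. integrable lebesgue f \<and> (AE x in lebesgue. x \<notin> A \<longrightarrow> f x = 0)}"

text \<open>
  An operator is a total function that is only meaningful on its domain \<open>D\<close>. The set \<open>D\<close> need not
  be a vector space: the conditions are imposed whenever all functions involved lie in \<open>D\<close>.
\<close>

definition sublinear_operator_on ::
  "(real ^ 'n \<Rightarrow> 'a::real_normed_field) set
     \<Rightarrow> ((real ^ 'n \<Rightarrow> 'a) \<Rightarrow> (real ^ 'n \<Rightarrow> 'a)) \<Rightarrow> bool" where
  "sublinear_operator_on D T \<longleftrightarrow>
     (\<forall>f\<in>D. T f \<in> borel_measurable lebesgue) \<and>
     (\<forall>f\<in>D. \<forall>g\<in>D. (\<lambda>x. f x + g x) \<in> D \<longrightarrow>
        (AE x in lebesgue. norm (T (\<lambda>x. f x + g x) x) \<le> norm (T f x) + norm (T g x))) \<and>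
     (\<forall>f\<in>D. \<forall>c. (\<lambda>x. c * f x) \<in> D \<longrightarrow>
        (AE x in lebesgue. norm (T (\<lambda>x. c * f x) x) = norm c * norm (T f x)))"

text \<open>
  Subadditivity along the decomposition of \<open>f\<close> into its (infinitely many) dyadic pieces. It is not
  a consequence of the binary subadditivity above.
\<close>

definition dyadically_subadditive_at ::
  "((real ^ 'n \<Rightarrow> 'a::real_normed_field) \<Rightarrow> (real ^ 'n \<Rightarrow> 'a)) \<Rightarrow> (real ^ 'n \<Rightarrow> 'a) \<Rightarrow> bool" where
  "dyadically_subadditive_at T f \<longleftrightarrow>
     (AE x in lebesgue. ennreal (norm (T f x)) \<le>
        (\<Sum>\<^sub>\<infinity> j :: int. ennreal (norm (T (restr (annulus j) f) x))))"

text \<open>The predicate takes the two (extended) norms and the two spaces on which they are finite.\<close>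

definition bounded_operator ::
  "('f \<Rightarrow> ennreal) \<Rightarrow> 'f set \<Rightarrow> ('g \<Rightarrow> ennreal) \<Rightarrow> 'g set \<Rightarrow> ('f \<Rightarrow> 'g) \<Rightarrow> bool" where
  "bounded_operator N X M Y T \<longleftrightarrow>
     (\<exists>C :: real. \<forall>f\<in>X. T f \<in> Y \<and> M (T f) \<le> ennreal C * N f)"

end

theory Submission
  imports Defs
begin

text \<open>
  Write \<open>f\<close> as the sum of its dyadic pieces \<open>f \<chi>\<^sub>j\<close>, let \<open>A = n - \<Sum> 1 / q1\<^sub>i\<close> and \<open>B = \<Sum> 1 / q2\<^sub>i\<close>, so that
  \<open>n - l = A + B\<close>. Hoelder's inequality on cubes bounds the \<open>L\<^sup>1\<close> norm of \<open>f \<chi>\<^sub>j\<close> by \<open>2\<^bsup>jA\<^esup>\<close> times its mixed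
  norm, and the mixed norm of \<open>\<chi>\<^sub>k\<close> is at most of order \<open>2\<^bsup>kB\<^esup>\<close>. The size conditions therefore give decay
  \<open>2\<^bsup>-(k-j)A\<^esup>\<close> for \<open>j \<le> k - 2\<close> and \<open>2\<^bsup>-(j-k)B\<^esup>\<close> for \<open>j \<ge> k + 2\<close>; the diagonal terms are handled by the boundedness
  between the mixed Lebesgue spaces. After weighting by \<open>2\<^bsup>k\<alpha>\<^esup>\<close> the hypotheses on \<open>\<alpha>\<close> turn this into a
  convolution with an exponentially decaying kernel, which acts boundedly on Morrey sequences.
  Finally the exponent \<open>p1\<close> is raised to \<open>p2\<close> by the nesting of the sequence spaces.
\<close>

section \<open>Powers and sums in the extended nonnegative reals\<close>

text \<open>The two bounds on \<alpha> have different shapes because the kernel acts on initial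
  segments \<open>{..k0}\<close>. Pieces with j < k belong to smaller segments, where the Morrey
  weight can only improve the decay, so \<alpha> < A is enough. Pieces with j > k may lie beyond k0
  and are controlled only through larger segments, at the price of a factor 2^((j-k) lam); hence
  their weighted decay rate B + \<alpha> must exceed lam. Cubes replace annuli in the norm estimates
  because a mixed norm factors over a product of intervals; this costs only constants. Exponents p <
  1 admit no triangle inequality, so for finite p the convolution is estimated at the level of p-th
  powers. It uses p1 on both sides, and the embedding comes last, which avoids an inequality between
  two different exponents. The infinitely many pieces inside a mixed norm call for a countable
  Minkowski inequality in every coordinate; working in \<open>ennreal\<close> keeps convergence
  questions out of the argument.\<close>

lemma epowr_ennreal: "0 \<le> x \<Longrightarrow> epowr (ennreal x) a = ennreal (x powr a)"
  by (simp add: epowr_def)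

lemma epowr_top [simp]: "epowr top a = top"
  by (simp add: epowr_def)

lemma epowr_0 [simp]: "epowr 0 a = 0"
  by (simp add: epowr_def)

lemma epowr_one_left [simp]: "epowr 1 a = 1"
  by (simp add: epowr_def)

lemma epowr_one [simp]: "epowr x 1 = x"
  by (cases x) (simp_all add: epowr_ennreal)

lemma epowr_eq_0_iff [simp]: "epowr x a = 0 \<longleftrightarrow> x = 0"
  by (cases x) (auto simp: epowr_ennreal)

lemma epowr_eq_top_iff [simp]: "epowr x a = top \<longleftrightarrow> x = top"
  by (cases x) (auto simp: epowr_ennreal)

lemma epowr_mono: "x \<le> y \<Longrightarrow> 0 \<le> a \<Longrightarrow> epowr x a \<le> epowr y a"
  by (cases x; cases y) (auto simp: epowr_ennreal top_unique intro!: ennreal_leI powr_mono2)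

text \<open>The convention 0 * top = 0 is respected because \<open>epowr\<close> fixes both 0 and
  top for every exponent.\<close>

lemma epowr_mult: "epowr (x * y) a = epowr x a * epowr y a"
  by (cases x; cases y)
     (auto simp: epowr_ennreal ennreal_mult_top ennreal_top_mult powr_mult simp flip: ennreal_mult)

lemma epowr_epowr: "epowr (epowr x a) b = epowr x (a * b)"
  by (cases x) (auto simp: epowr_ennreal powr_powr)

lemma borel_measurable_epowr [measurable]:
  assumes [measurable]: "f \<in> borel_measurable M"
  shows "(\<lambda>x. epowr (f x) a) \<in> borel_measurable M"
  unfolding epowr_def infinity_ennreal_def by measurable

lemma epowr_le_iff: "0 < a \<Longrightarrow> epowr x a \<le> y \<longleftrightarrow> x \<le> epowr y (1 / a)"
  using epowr_mono[of "epowr x a" y "1 / a"] epowr_mono[of x "epowr y (1 / a)" a]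
  by (auto simp: epowr_epowr)

section \<open>Countable sums as integrals, and the convexity inequalities for powers\<close>

text \<open>Turns the sums of the definitions into integrals, so that Jensen, Fubini and reindexing
  are available for sums and integrals alike. The larger side is reached by exhausting
  \<open>A\<close> with the finite sets of elements of code at most \<open>n\<close> and monotone
  convergence.\<close>

lemma infsum_eq_nn_integral_count_space:
  fixes f :: "'b \<Rightarrow> ennreal"
  assumes "countable A"
  shows "infsum f A = (\<integral>\<^sup>+ x. f x \<partial>count_space A)"
proof (rule antisym)
  have "sum f F \<le> (\<integral>\<^sup>+ x. f x \<partial>count_space A)" if "finite F" "F \<subseteq> A" for F
  proof -
    have "sum f F = (\<integral>\<^sup>+ x. f x \<partial>count_space F)"
      using that by (simp add: nn_integral_count_space_finite)
    also have "\<dots> \<le> (\<integral>\<^sup>+ x. f x \<partial>count_space A)"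
      using that by (auto simp: nn_integral_count_space_indicator intro!: nn_integral_mono split: split_indicator)
    finally show ?thesis .
  qed
  then show "infsum f A \<le> (\<integral>\<^sup>+ x. f x \<partial>count_space A)"
    by (auto simp: nonneg_infsum_complete intro!: SUP_least)
next
  define F where "F n = A \<inter> to_nat_on A -` {..n}" for n :: nat
  have fin: "finite (F n)" for n
    unfolding F_def Int_commute[of A]
    using inj_on_to_nat_on[OF assms] by (rule finite_vimage_IntI[OF finite_atMost])
  have "(\<integral>\<^sup>+ x. f x \<partial>count_space A) = (\<integral>\<^sup>+ x. (SUP n. f x * indicator (F n) x) \<partial>count_space A)"
  proof (rule nn_integral_cong)
    fix x assume "x \<in> space (count_space A)"
    then have "x \<in> F (to_nat_on A x)" by (auto simp: F_def)
    then show "f x = (SUP n. f x * indicator (F n) x)"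
      by (intro antisym SUP_least SUP_upper2[of "to_nat_on A x"]) (auto split: split_indicator)
  qed
  also have "\<dots> = (SUP n. \<integral>\<^sup>+ x. f x * indicator (F n) x \<partial>count_space A)"
    by (rule nn_integral_monotone_convergence_SUP)
       (auto simp: incseq_def F_def le_fun_def split: split_indicator)
  also have "\<dots> = (SUP n. sum f (F n))"
  proof (rule SUP_cong)
    fix n
    have "F n \<subseteq> A" by (auto simp: F_def)
    then have "(\<integral>\<^sup>+ x. f x * indicator (F n) x \<partial>count_space A) = (\<integral>\<^sup>+ x. f x \<partial>count_space (F n))"
      by (auto simp: nn_integral_count_space_indicator intro!: nn_integral_cong split: split_indicator)
    then show "(\<integral>\<^sup>+ x. f x * indicator (F n) x \<partial>count_space A) = sum f (F n)"
      using fin by (simp add: nn_integral_count_space_finite)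
  qed simp
  also have "\<dots> \<le> infsum f A"
    using fin by (auto simp: nonneg_infsum_complete F_def intro!: SUP_least SUP_upper)
  finally show "(\<integral>\<^sup>+ x. f x \<partial>count_space A) \<le> infsum f A" .
qed

text \<open>The right side is the tangent at \<open>s powr a\<close> of the concave function
  u^(1/a), evaluated at u = \<open>g powr a\<close>. It bounds \<open>g\<close> by an affine
  function of its \<open>a\<close>-th power, with \<open>s\<close> free.\<close>

lemma powr_Young:
  fixes g s a :: real
  assumes "0 \<le> g" "0 < s" "1 \<le> a"
  shows "g \<le> s powr (1 - a) / a * g powr a + (1 - 1 / a) * s"
proof (cases "g = 0")
  case False
  have "((g / s) powr a) powr (1 / a) * 1 powr (1 - 1 / a) \<le> 1 / a * ((g / s) powr a) + (1 - 1 / a) * 1"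
    using assms False by (intro Youngs_inequality_0) auto
  then have "g / s \<le> 1 / a * ((g / s) powr a) + (1 - 1 / a)"
    using assms False by (simp add: powr_powr)
  then have "g \<le> (1 / a * ((g / s) powr a) + (1 - 1 / a)) * s"
    using assms by (simp add: field_simps)
  also have "\<dots> = s powr (1 - a) / a * g powr a + (1 - 1 / a) * s"
    using assms by (simp add: powr_diff powr_divide field_simps)
  finally show ?thesis .
qed (use assms in simp)

text \<open>\<open>powr_Young\<close> is integrated against the weight with one \<open>s\<close> for
  all points, and then \<open>s\<close> is optimised; \<open>w\<close> need not be normalised to a
  probability density. \<open>Z = 0\<close> and \<open>Z = top\<close> are split off because the
  optimal \<open>s\<close> degenerates there.\<close>

lemma epowr_nn_integral_Jensen:
  fixes w g :: "'b \<Rightarrow> ennreal"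
  assumes [measurable]: "w \<in> borel_measurable M" "g \<in> borel_measurable M"
    and "1 \<le> a" and H: "(\<integral>\<^sup>+ x. w x \<partial>M) = ennreal H" "0 < H"
  shows "epowr (\<integral>\<^sup>+ x. w x * g x \<partial>M) a \<le> ennreal (H powr (a - 1)) * (\<integral>\<^sup>+ x. w x * epowr (g x) a \<partial>M)"
proof -
  define Z where "Z = (\<integral>\<^sup>+ x. w x * epowr (g x) a \<partial>M)"
  consider "Z = top" | "Z = 0" | z where "Z = ennreal z" "0 < z"
    by (cases Z) (auto simp: less_le)
  then show ?thesis
  proof cases
    case 1
    then show ?thesis using H by (simp add: Z_def ennreal_mult_top)
  next
    case 2
    then have "AE x in M. w x * epowr (g x) a = 0"
      by (simp add: Z_def nn_integral_0_iff_AE)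
    then have "AE x in M. w x * g x = 0" by auto
    then have "(\<integral>\<^sup>+ x. w x * g x \<partial>M) = 0"
      by (simp add: nn_integral_0_iff_AE)
    then show ?thesis by simp
  next
    case 3
    \<comment> \<open>Chosen so that \<open>H * s powr a = z\<close>. The two terms of the
      integrated bound then become the fractions \<open>1 / a\<close> and \<open>1 - 1 / a\<close>
      of \<open>H * s\<close>.\<close>
    define s where "s = (z / H) powr (1 / a)"
    have s: "0 < s" "z = H * s powr a"
      using 3 H assms(3) by (auto simp: s_def powr_powr)
    have *: "g x \<le> ennreal (s powr (1 - a) / a) * epowr (g x) a + ennreal ((1 - 1 / a) * s)" for x
    proof (cases "g x")
      case (real r)
      then show ?thesis
        using powr_Young[of r s a] s assms(3)
        by (auto simp: epowr_ennreal simp flip: ennreal_mult ennreal_plus intro!: ennreal_leI)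
    next
      case top
      have "0 < s powr (1 - a) / a" using s assms(3) by simp
      then show ?thesis using top s assms(3) by (simp add: ennreal_mult_top)
    qed
    have "(\<integral>\<^sup>+ x. w x * g x \<partial>M) \<le>
        (\<integral>\<^sup>+ x. ennreal (s powr (1 - a) / a) * (w x * epowr (g x) a) + w x * ennreal ((1 - 1 / a) * s) \<partial>M)"
      using mult_left_mono[OF *, of "w _"] by (intro nn_integral_mono) (simp add: algebra_simps)
    also have "\<dots> = ennreal (s powr (1 - a) / a) * Z + ennreal H * ennreal ((1 - 1 / a) * s)"
      by (simp add: nn_integral_add nn_integral_cmult nn_integral_multc Z_def H)
    also have "\<dots> = ennreal (s powr (1 - a) / a * z + H * ((1 - 1 / a) * s))"
    proof -
      have "0 \<le> (1 - 1 / a) * s" using s(1) assms(3) by simp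
      moreover have "0 \<le> s powr (1 - a) / a" using assms(3) by simp
      ultimately show ?thesis
        unfolding 3(1) using H(2) 3(2) by (simp only: ennreal_plus ennreal_mult mult_nonneg_nonneg less_imp_le)
    qed
    also have "s powr (1 - a) / a * z + H * ((1 - 1 / a) * s) = H * s"
      using s assms(3) by (simp add: s(2) powr_diff field_simps)
    finally have "epowr (\<integral>\<^sup>+ x. w x * g x \<partial>M) a \<le> epowr (ennreal (H * s)) a"
      using assms(3) by (intro epowr_mono) auto
    also have "\<dots> = ennreal (H powr (a - 1)) * ennreal z"
      using s H assms(3) by (simp add: epowr_ennreal powr_mult powr_diff field_simps flip: ennreal_mult)
    finally show ?thesis using 3 by (simp add: Z_def)
  qed
qed

lemma epowr_sum_subadditive:
  fixes g :: "'b \<Rightarrow> ennreal"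
  assumes "0 < a" "a \<le> 1"
  shows "epowr (\<integral>\<^sup>+ i. g i \<partial>count_space A) a \<le> (\<integral>\<^sup>+ i. epowr (g i) a \<partial>count_space A)"
proof -
  define Z where "Z = (\<integral>\<^sup>+ i. epowr (g i) a \<partial>count_space A)"
  consider "Z = top" | "Z = 0" | z where "Z = ennreal z" "0 < z"
    by (cases Z) (auto simp: less_le)
  then show ?thesis
  proof cases
    case 1
    then show ?thesis by (simp add: Z_def)
  next
    case 2
    then have "AE i in count_space A. g i = 0"
      unfolding Z_def by (subst (asm) nn_integral_0_iff_AE) auto
    then have "(\<integral>\<^sup>+ i. g i \<partial>count_space A) = 0"
      by (subst nn_integral_0_iff_AE) auto
    then show ?thesis by simp
  next
    case 3
    \<comment> \<open>Since \<open>g i \<le> Z powr (1 / a)\<close>, the quotient of the two is at most its \<open>a\<close>-th power.\<close>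
    define c where "c = z powr (1 / a - 1)"
    have *: "g i \<le> ennreal c * epowr (g i) a" if "i \<in> A" for i
    proof -
      have le: "epowr (g i) a \<le> ennreal z"
        using nn_integral_ge_point[OF that, of "\<lambda>i. epowr (g i) a"] 3 by (simp add: Z_def)
      then obtain r where r: "g i = ennreal r" "0 \<le> r"
        by (cases "g i") (auto simp: top_unique)
      then have rz: "r powr a \<le> z" using le 3 by (simp add: epowr_ennreal)
      have "r = (r powr a) powr (1 / a - 1) * r powr a"
      proof (cases "r = 0")
        case False
        then have "(r powr a) powr (1 / a - 1) * r powr a = r powr (a * (1 / a - 1) + a)"
          by (simp only: powr_powr powr_add)
        also have "a * (1 / a - 1) + a = 1" using assms by (simp add: field_simps)
        finally show ?thesis using r False by simp
      qed simp
      also have "\<dots> \<le> c * r powr a"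
        unfolding c_def using rz assms by (intro mult_right_mono powr_mono2) auto
      finally show ?thesis using r
        by (auto simp: epowr_ennreal c_def simp flip: ennreal_mult intro!: ennreal_leI)
    qed
    have "(\<integral>\<^sup>+ i. g i \<partial>count_space A) \<le> (\<integral>\<^sup>+ i. ennreal c * epowr (g i) a \<partial>count_space A)"
      using * by (intro nn_integral_mono) auto
    also have "\<dots> = ennreal c * ennreal z" using 3 by (simp add: nn_integral_cmult Z_def)
    also have "\<dots> = ennreal (z powr (1 / a))"
      using 3 by (simp add: c_def powr_diff flip: ennreal_mult)
    finally have "epowr (\<integral>\<^sup>+ i. g i \<partial>count_space A) a \<le> epowr (ennreal (z powr (1 / a))) a"
      using assms by (intro epowr_mono) auto
    then show ?thesis using 3 assms by (simp add: epowr_ennreal powr_powr Z_def)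
  qed
qed

lemma borel_measurabnn_integral_ge_point:
  fixes g :: "'i \<Rightarrow> 'b \<Rightarrow> ennreal"
  assumes "countable A" and "\<And>i. i \<in> A \<Longrightarrow> g i \<in> borel_measurable M"
  shows "(\<lambda>x. \<integral>\<^sup>+ i. g i x \<partial>count_space A) \<in> borel_measurable M"
proof -
  interpret sigma_finite_measure "count_space A"
    using assms(1) by (rule sigma_finite_measure_count_space_countable)
  have "(\<lambda>(i, x). g i x) \<in> borel_measurable (count_space A \<Otimes>\<^sub>M M)"
    using assms by (intro measurable_pair_measure_countable1) auto
  then have "(\<lambda>(x, i). g i x) \<in> borel_measurable (M \<Otimes>\<^sub>M count_space A)"
    by (subst (asm) measurable_pair_swap_iff) (simp add: case_prod_beta')
  then show ?thesis by (rule borel_measurable_nn_integral)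
qed

text \<open>Jensen with the norms themselves as weights: with \<open>w i\<close> the
  \<open>a\<close>-norm of \<open>g i\<close>, the sum is that of
  \<open>w i * (g i x / w i)\<close>, and each quotient has norm 1, so integration leaves H^(a-1) *
  H. No dual exponent occurs and infinite sums need no limit argument.\<close>

lemma nn_integral_Minkowski:
  fixes g :: "'i \<Rightarrow> 'b \<Rightarrow> ennreal"
  assumes "countable A" and [measurable]: "\<And>i. i \<in> A \<Longrightarrow> g i \<in> borel_measurable M" and a: "1 \<le> a"
  shows "epowr (\<integral>\<^sup>+ x. epowr (\<integral>\<^sup>+ i. g i x \<partial>count_space A) a \<partial>M) (1 / a)
    \<le> (\<integral>\<^sup>+ i. epowr (\<integral>\<^sup>+ x. epowr (g i x) a \<partial>M) (1 / a) \<partial>count_space A)"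
proof -
  define w where "w i = epowr (\<integral>\<^sup>+ x. epowr (g i x) a \<partial>M) (1 / a)" for i
  define W where "W = (\<integral>\<^sup>+ i. w i \<partial>count_space A)"
  have w: "(\<integral>\<^sup>+ x. epowr (g i x) a \<partial>M) = epowr (w i) a" for i
    using a by (simp add: w_def epowr_epowr)
  have "AE x in M. w i = 0 \<longrightarrow> g i x = 0" if "i \<in> A" for i
  proof (cases "w i = 0")
    case True
    then have "(\<integral>\<^sup>+ x. epowr (g i x) a \<partial>M) = 0" by (simp add: w)
    then have "AE x in M. epowr (g i x) a = 0"
      using that by (subst (asm) nn_integral_0_iff_AE) auto
    then show ?thesis by simp
  qed simp
  \<comment> \<open>Where \<open>w i = 0\<close> the quotient by \<open>w i\<close> is useless, but
    \<open>g i\<close> vanishes almost everywhere; countability of \<open>A\<close> provides one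
    null set for all such \<open>i\<close>.\<close>
  then have zero: "AE x in M. \<forall>i\<in>A. w i = 0 \<longrightarrow> g i x = 0"
    using \<open>countable A\<close> by (simp add: AE_ball_countable)
  consider "W = top" | "W = 0" | H where "W = ennreal H" "0 < H"
    by (cases W) (auto simp: less_le)
  then show ?thesis
  proof cases
    case 1
    then show ?thesis by (simp add: W_def w_def)
  next
    case 2
    then have "w i = 0" if "i \<in> A" for i
      using nn_integral_ge_point[OF that, of w] by (simp add: W_def)
    with zero have "AE x in M. \<forall>i\<in>A. g i x = 0" by auto
    then have "AE x in M. epowr (\<integral>\<^sup>+ i. g i x \<partial>count_space A) a = 0"
      by eventually_elim (simp add: nn_integral_0_iff_AE AE_count_space)
    then have "(\<integral>\<^sup>+ x. epowr (\<integral>\<^sup>+ i. g i x \<partial>count_space A) a \<partial>M) = (\<integral>\<^sup>+ x. 0 \<partial>M)"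
      by (rule nn_integral_cong_AE)
    then show ?thesis by simp
  next
    case 3
    have fin: "w i < top" if "i \<in> A" for i
      using nn_integral_ge_point[OF that, of w] 3
      by (metis W_def ennreal_less_top le_less_trans)
    have "(\<integral>\<^sup>+ x. epowr (\<integral>\<^sup>+ i. g i x \<partial>count_space A) a \<partial>M)
        \<le> (\<integral>\<^sup>+ x. ennreal (H powr (a - 1)) * (\<integral>\<^sup>+ i. w i * epowr (g i x / w i) a \<partial>count_space A) \<partial>M)"
    proof (rule nn_integral_mono_AE, use zero in eventually_elim)
      fix x assume x: "\<forall>i\<in>A. w i = 0 \<longrightarrow> g i x = 0"
      have "(\<integral>\<^sup>+ i. g i x \<partial>count_space A) = (\<integral>\<^sup>+ i. w i * (g i x / w i) \<partial>count_space A)"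
        using x fin by (intro nn_integral_cong)
          (auto simp: ennreal_times_divide mult.commute[of "w _"] ennreal_mult_divide_eq less_top)
      then show "epowr (\<integral>\<^sup>+ i. g i x \<partial>count_space A) a
          \<le> ennreal (H powr (a - 1)) * (\<integral>\<^sup>+ i. w i * epowr (g i x / w i) a \<partial>count_space A)"
        using 3 a by (auto simp: W_def intro!: epowr_nn_integral_Jensen)
    qed
    also have "\<dots> = ennreal (H powr (a - 1)) *
        (\<integral>\<^sup>+ i. w i * (\<integral>\<^sup>+ x. epowr (g i x / w i) a \<partial>M) \<partial>count_space A)"
      using \<open>countable A\<close>
      by (simp add: nn_integral_cmult nn_integral_count_space_nn_integral borel_measurabnn_integral_ge_point cong: nn_integral_cong_simp)
    also have "\<dots> \<le> ennreal (H powr (a - 1)) * (\<integral>\<^sup>+ i. w i * 1 \<partial>count_space A)"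
    proof (rule mult_left_mono[OF nn_integral_mono])
      fix i assume "i \<in> space (count_space A)"
      then have i: "i \<in> A" by simp
      show "w i * (\<integral>\<^sup>+ x. epowr (g i x / w i) a \<partial>M) \<le> w i * 1"
      proof (cases "w i = 0")
        case False
        have "(\<integral>\<^sup>+ x. epowr (g i x / w i) a \<partial>M) = (\<integral>\<^sup>+ x. epowr (g i x) a * epowr (inverse (w i)) a \<partial>M)"
          by (simp add: divide_ennreal_def epowr_mult)
        also have "\<dots> = epowr (w i) a * epowr (inverse (w i)) a"
          using i by (simp add: nn_integral_multc w)
        also have "\<dots> = epowr (w i / w i) a"
          by (simp add: divide_ennreal_def epowr_mult)
        also have "w i / w i = 1" using False fin[OF i] by (simp add: less_top)
        finally show ?thesis by simp
      qed simp
    qed simp_all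
    also have "\<dots> = epowr W a"
      using 3 by (simp add: W_def[symmetric] epowr_ennreal powr_diff flip: ennreal_mult)
    finally show ?thesis
      using a by (subst epowr_le_iff) (auto simp: epowr_epowr W_def w_def)
  qed
qed

section \<open>Mixed norms\<close>

text \<open>As a displacement along an axis, the update becomes accessible to translation invariance
  of \<open>lborel\<close> and to the measurability rules.\<close>

lemma upd_coord_eq: "upd_coord y i t = y + (t - y $ i) *\<^sub>R axis i 1"
  by (vector upd_coord_def axis_def)

lemma upd_coord_nth [simp]: "upd_coord y i t $ j = (if j = i then t else y $ j)"
  by (simp add: upd_coord_def)

lemma borel_measurable_upd_coord [measurable (raw)]:
  fixes f :: "'b \<Rightarrow> real ^ 'n"
  assumes [measurable]: "f \<in> borel_measurable M" "g \<in> borel_measurable M"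
  shows "(\<lambda>x. upd_coord (f x) i (g x)) \<in> borel_measurable M"
  unfolding upd_coord_eq cart_eq_inner_axis by measurable

lemma nn_integral_lborel_translation:
  fixes f :: "'b::euclidean_space \<Rightarrow> ennreal"
  assumes [measurable]: "f \<in> borel_measurable borel"
  shows "(\<integral>\<^sup>+ x. f (c + x) \<partial>lborel) = (\<integral>\<^sup>+ x. f x \<partial>lborel)"
  by (subst (2) lborel_distr_plus[of c, symmetric]) (simp add: nn_integral_distr)

text \<open>Integrating over \<open>y\<close> and over the line through \<open>y\<close> in direction \<open>i\<close> is symmetric in the two
  points. This replaces the identification of \<open>real ^ 'n\<close> with an iterated product.\<close>

lemma nn_integral_upd_coord_swap:
  fixes K :: "real ^ 'n \<Rightarrow> real ^ 'n \<Rightarrow> ennreal"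
  assumes [measurable]: "case_prod K \<in> borel_measurable (borel \<Otimes>\<^sub>M borel)"
  shows "(\<integral>\<^sup>+ y. \<integral>\<^sup>+ t. K y (upd_coord y i t) \<partial>lborel \<partial>lborel) =
         (\<integral>\<^sup>+ y. \<integral>\<^sup>+ t. K (upd_coord y i t) y \<partial>lborel \<partial>lborel)"
proof -
  \<comment> \<open>The two points become \<open>y\<close> and \<open>y + s *\<^sub>R e\<close>.
    Translating \<open>y\<close> at fixed \<open>s\<close> moves the displacement to the other
    argument, and a reflection in \<open>s\<close> restores \<open>upd_coord\<close>.\<close>
  define e :: "real ^ 'n" where "e = axis i 1"
  have line: "upd_coord y i (y $ i + s) = y + s *\<^sub>R e" for y s
    by (simp add: upd_coord_eq e_def)
  have "(\<integral>\<^sup>+ y. \<integral>\<^sup>+ t. K y (upd_coord y i t) \<partial>lborel \<partial>lborel) =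
      (\<integral>\<^sup>+ y. \<integral>\<^sup>+ s. K y (y + s *\<^sub>R e) \<partial>lborel \<partial>lborel)"
  proof (rule nn_integral_cong)
    fix y
    show "(\<integral>\<^sup>+ t. K y (upd_coord y i t) \<partial>lborel) = (\<integral>\<^sup>+ s. K y (y + s *\<^sub>R e) \<partial>lborel)"
      by (subst nn_integral_lborel_translation[symmetric, where c="y $ i"]) (simp_all add: line)
  qed
  also have "\<dots> = (\<integral>\<^sup>+ s. \<integral>\<^sup>+ y. K y (y + s *\<^sub>R e) \<partial>lborel \<partial>lborel)"
    by (rule lborel_pair.Fubini') measurable
  also have "\<dots> = (\<integral>\<^sup>+ s. \<integral>\<^sup>+ y. K (y - s *\<^sub>R e) y \<partial>lborel \<partial>lborel)"
  proof (rule nn_integral_cong)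
    fix s :: real
    show "(\<integral>\<^sup>+ y. K y (y + s *\<^sub>R e) \<partial>lborel) = (\<integral>\<^sup>+ y. K (y - s *\<^sub>R e) y \<partial>lborel)"
      by (subst nn_integral_lborel_translation[symmetric, where c="- s *\<^sub>R e"]) simp_all
  qed
  also have "\<dots> = (\<integral>\<^sup>+ y. \<integral>\<^sup>+ s. K (y - s *\<^sub>R e) y \<partial>lborel \<partial>lborel)"
    by (rule lborel_pair.Fubini'[symmetric]) measurable
  also have "\<dots> = (\<integral>\<^sup>+ y. \<integral>\<^sup>+ t. K (upd_coord y i t) y \<partial>lborel \<partial>lborel)"
  proof (rule nn_integral_cong)
    fix y
    have "(\<integral>\<^sup>+ s. K (y - s *\<^sub>R e) y \<partial>lborel) = (\<integral>\<^sup>+ t. K ((\<lambda>t. y - (y $ i + (- 1) * t) *\<^sub>R e) t) y \<partial>lborel)"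
      by (subst nn_integral_real_affine[where c="-1" and t="y $ i"]) simp_all
    also have "(\<lambda>t. y - (y $ i + (- 1) * t) *\<^sub>R e) = upd_coord y i"
      by (simp add: fun_eq_iff upd_coord_eq e_def algebra_simps)
    finally show "(\<integral>\<^sup>+ s. K (y - s *\<^sub>R e) y \<partial>lborel) = (\<integral>\<^sup>+ t. K (upd_coord y i t) y \<partial>lborel)" .
  qed
  finally show ?thesis .
qed

text \<open>Swapping the two points turns the measure of a line section of a null set
  \<open>N\<close> into the integral of \<open>indicator N y\<close> over a whole line. This is
  infinite on \<open>N\<close>, but the outer integral is still 0 because \<open>N\<close> is
  null.\<close>

lemma AE_upd_coord:
  fixes P :: "real ^ 'n \<Rightarrow> bool"
  assumes "AE x in lborel. P x"
  shows "AE y in lborel. AE t in lborel. P (upd_coord y i t)"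
proof -
  obtain N where N: "{x \<in> space lborel. \<not> P x} \<subseteq> N" "emeasure lborel N = 0" and [measurable]: "N \<in> sets borel"
    using AE_E[OF assms] by (metis sets_lborel)
  have "(\<integral>\<^sup>+ y. \<integral>\<^sup>+ t. indicator N (upd_coord y i t) \<partial>lborel \<partial>lborel) =
      (\<integral>\<^sup>+ y. \<integral>\<^sup>+ t. indicator N (y :: real ^ 'n) \<partial>(lborel :: real measure) \<partial>lborel)"
    by (rule nn_integral_upd_coord_swap[where K="\<lambda>y z. indicator N z"]) measurable
  also have "\<dots> = 0" using N by (simp add: nn_integral_multc)
  finally have "AE y in lborel. (\<integral>\<^sup>+ t. indicator N (upd_coord y i t) \<partial>lborel) = 0"
    by (subst (asm) nn_integral_0_iff_AE) auto
  then show ?thesis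
  proof eventually_elim
    fix y assume "(\<integral>\<^sup>+ t. indicator N (upd_coord y i t) \<partial>lborel) = 0"
    then have "AE t in lborel. indicator N (upd_coord y i t) = (0 :: ennreal)"
      by (subst (asm) nn_integral_0_iff_AE) auto
    then show "AE t in lborel. P (upd_coord y i t)"
      by eventually_elim (use N(1) in \<open>auto split: split_indicator_asm\<close>)
  qed
qed

section \<open>Monotonicity, dependence on coordinates and Minkowski for iterated norms\<close>

text \<open>Completing the measure does not change a nonnegative integral. All inductions use this
  form, since Fubini and measurability of sections are Borel statements; the \<open>lebesgue\<close>
  equation therefore leaves the simpset.\<close>

lemma mixed_iter_Cons_lborel:
  "mixed_iter q r (i # is) F x =
     mixed_iter q (q $ i) is (\<lambda>y. \<integral>\<^sup>+ t. epowr (F (upd_coord y i t)) (q $ i / r) \<partial>lborel) x"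
  by (simp add: nn_integral_completion)

declare mixed_iter.simps(2) [simp del]

text \<open>The induction needs the inequality for almost every evaluation point. Once all coordinates are
  integrated out the result is constant, and the exceptional set disappears.\<close>

lemma mixed_iter_mono_AE:
  assumes "\<And>i. 0 < q $ i" "0 < r" "AE y in lborel. F y \<le> G y"
  shows "AE y in lborel. mixed_iter q r L F y \<le> mixed_iter q r L G y"
  using assms(2,3)
proof (induction L arbitrary: r F G)
  case Nil
  from Nil(2) show ?case by eventually_elim (use Nil(1) in \<open>simp add: epowr_mono\<close>)
next
  case (Cons i L)
  have "AE y in lborel. (\<integral>\<^sup>+ t. epowr (F (upd_coord y i t)) (q $ i / r) \<partial>lborel)
      \<le> (\<integral>\<^sup>+ t. epowr (G (upd_coord y i t)) (q $ i / r) \<partial>lborel)"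
    using AE_upd_coord[OF Cons.prems(2), of i]
  proof eventually_elim
    fix y assume "AE t in lborel. F (upd_coord y i t) \<le> G (upd_coord y i t)"
    then have "AE t in lborel. epowr (F (upd_coord y i t)) (q $ i / r) \<le> epowr (G (upd_coord y i t)) (q $ i / r)"
      by eventually_elim (use assms(1)[of i] Cons.prems(1) in \<open>simp add: epowr_mono\<close>)
    then show "(\<integral>\<^sup>+ t. epowr (F (upd_coord y i t)) (q $ i / r) \<partial>lborel)
      \<le> (\<integral>\<^sup>+ t. epowr (G (upd_coord y i t)) (q $ i / r) \<partial>lborel)"
      by (rule nn_integral_mono_AE)
  qed
  from Cons.IH[OF assms(1) this] show ?case by (simp add: mixed_iter_Cons_lborel)
qed

text \<open>Each integration removes one coordinate from the set on which the value may depend. With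
  \<open>S = UNIV\<close> and the full list nothing remains, so the evaluation point is
  arbitrary.\<close>

lemma mixed_iter_cong_coords:
  assumes "\<And>y z. (\<And>j. j \<in> S \<Longrightarrow> y $ j = z $ j) \<Longrightarrow> F y = F z"
    and "\<And>j. j \<in> S - set L \<Longrightarrow> y $ j = z $ j"
  shows "mixed_iter q r L F y = mixed_iter q r L F z"
  using assms
proof (induction L arbitrary: r F S)
  case Nil
  have "F y = F z" by (rule Nil(1)) (use Nil(2) in auto)
  then show ?case by simp
next
  case (Cons i L)
  show ?case unfolding mixed_iter_Cons_lborel
  proof (rule Cons.IH[where S="S - {i}"])
    fix y z :: "real ^ 'a" assume *: "\<And>j. j \<in> S - {i} \<Longrightarrow> y $ j = z $ j"
    have "F (upd_coord y i t) = F (upd_coord z i t)" for t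
      by (rule Cons.prems(1)) (use * in auto)
    then show "(\<integral>\<^sup>+ t. epowr (F (upd_coord y i t)) (q $ i / r) \<partial>lborel) =
        (\<integral>\<^sup>+ t. epowr (F (upd_coord z i t)) (q $ i / r) \<partial>lborel)" by simp
  qed (use Cons.prems(2) in auto)
qed

text \<open>The triangle inequality is assumed for \<open>1 / r\<close>-th powers because this form
  survives the induction: after one integration the intermediate value is a \<open>q $ i\<close>-th
  power of a norm, and only its root is subadditive.\<close>

lemma mixed_iter_Minkowski:
  assumes A: "countable A" and q: "\<And>i. 1 \<le> q $ i"
    and "0 < r" "\<And>j. j \<in> A \<Longrightarrow> G j \<in> borel_measurable borel"
    and "\<And>y. epowr (F y) (1 / r) \<le> (\<integral>\<^sup>+ j. epowr (G j y) (1 / r) \<partial>count_space A)"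
  shows "mixed_iter q r L F y \<le> (\<integral>\<^sup>+ j. mixed_iter q r L (G j) y \<partial>count_space A)"
  using assms(3-)
proof (induction L arbitrary: r F G)
  case Nil
  then show ?case by simp
next
  case (Cons i L)
  note [measurable] = Cons.prems(2)
  have qi: "1 \<le> q $ i" by (rule q)
  have step: "epowr (\<integral>\<^sup>+ t. epowr (F (upd_coord y i t)) (q $ i / r) \<partial>lborel) (1 / q $ i)
      \<le> (\<integral>\<^sup>+ j. epowr (\<integral>\<^sup>+ t. epowr (G j (upd_coord y i t)) (q $ i / r) \<partial>lborel) (1 / q $ i) \<partial>count_space A)" for y
  proof -
    have split: "epowr x (q $ i / r) = epowr (epowr x (1 / r)) (q $ i)" for x
      by (simp add: epowr_epowr)
    have "epowr (\<integral>\<^sup>+ t. epowr (F (upd_coord y i t)) (q $ i / r) \<partial>lborel) (1 / q $ i) \<le>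
      epowr (\<integral>\<^sup>+ t. epowr (\<integral>\<^sup>+ j. epowr (G j (upd_coord y i t)) (1 / r) \<partial>count_space A) (q $ i) \<partial>lborel) (1 / q $ i)"
      unfolding split using qi by (intro epowr_mono nn_integral_mono Cons.prems(3)) auto
    also have "\<dots> \<le> (\<integral>\<^sup>+ j. epowr (\<integral>\<^sup>+ t. epowr (epowr (G j (upd_coord y i t)) (1 / r)) (q $ i) \<partial>lborel) (1 / q $ i) \<partial>count_space A)"
      using qi by (intro nn_integral_Minkowski A) auto
    finally show ?thesis by (simp add: split)
  qed
  show ?case unfolding mixed_iter_Cons_lborel
    using qi by (intro Cons.IH step) auto
qed

text \<open>The mixed norm for \<open>ennreal\<close>-valued functions: the sum over all pieces of
  their pointwise norms may be infinite, so it is not the norm of a function with values in the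
  scalar field.\<close>

definition emixed_norm :: "real ^ 'n::{finite,linorder} \<Rightarrow> (real ^ 'n::{finite,linorder} \<Rightarrow> ennreal) \<Rightarrow> ennreal" where
  "emixed_norm q F = mixed_iter q 1 (sorted_list_of_set UNIV) F 0"

lemma mixed_norm_eq_emixed_norm: "mixed_norm q f = emixed_norm q (\<lambda>x. ennreal (norm (f x)))"
  by (simp add: mixed_norm_def emixed_norm_def)

lemma mixed_iter_eq_emixed_norm:
  "mixed_iter q 1 (sorted_list_of_set UNIV) F y = emixed_norm q F"
proof -
  have "F y = F z" if "\<And>j. j \<in> UNIV \<Longrightarrow> y $ j = z $ j" for y z
    using that by (metis UNIV_I vec_eq_iff)
  then show ?thesis
    unfolding emixed_norm_def by (rule mixed_iter_cong_coords[where S=UNIV]) auto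
qed

lemma AE_lborel_const [simp]: "(AE x in (lborel :: 'b::euclidean_space measure). P) \<longleftrightarrow> P"
proof -
  have "ae_filter (lborel :: 'b measure) \<noteq> bot"
    by (simp add: ae_filter_eq_bot_iff)
  then show ?thesis by simp
qed

lemma emixed_norm_mono_AE:
  assumes "\<And>i. 0 < q $ i" "AE x in lebesgue. F x \<le> G x"
  shows "emixed_norm q F \<le> emixed_norm q G"
proof -
  have "AE y in lborel. mixed_iter q 1 (sorted_list_of_set UNIV) F y \<le> mixed_iter q 1 (sorted_list_of_set UNIV) G y"
    using assms by (intro mixed_iter_mono_AE) (auto simp: AE_completion_iff)
  then show ?thesis by (simp add: mixed_iter_eq_emixed_norm)
qed

lemma emixed_norm_Minkowski:
  assumes "countable A" and q: "\<And>i. 1 \<le> q $ i" and G: "\<And>j. j \<in> A \<Longrightarrow> G j \<in> borel_measurable lebesgue"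
  shows "emixed_norm q (\<lambda>x. \<integral>\<^sup>+ j. G j x \<partial>count_space A) \<le> (\<integral>\<^sup>+ j. emixed_norm q (G j) \<partial>count_space A)"
proof -
  have q0: "0 < q $ i" for i using q[of i] by linarith
  \<comment> \<open>Line sections of Lebesgue measurable functions can fail to be measurable, so
    Borel representatives enter the induction; countability of \<open>A\<close> makes them agree off
    one null set.\<close>
  have "\<forall>j\<in>A. \<exists>g\<in>borel_measurable borel. AE x in lebesgue. G j x = g x"
    using G completion_ex_borel_measurable[of _ lborel] by (auto simp: AE_completion_iff)
  then obtain g where g: "\<And>j. j \<in> A \<Longrightarrow> g j \<in> borel_measurable borel"
      "\<And>j. j \<in> A \<Longrightarrow> AE x in lebesgue. G j x = g j x"
    by metis
  have "AE x in lebesgue. \<forall>j\<in>A. G j x = g j x"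
    using g(2) \<open>countable A\<close> by (simp add: AE_ball_countable)
  then have "AE x in lebesgue. (\<integral>\<^sup>+ j. G j x \<partial>count_space A) \<le> (\<integral>\<^sup>+ j. g j x \<partial>count_space A)"
    by eventually_elim (auto intro!: nn_integral_mono)
  then have "emixed_norm q (\<lambda>x. \<integral>\<^sup>+ j. G j x \<partial>count_space A) \<le> emixed_norm q (\<lambda>x. \<integral>\<^sup>+ j. g j x \<partial>count_space A)"
    by (rule emixed_norm_mono_AE[OF q0])
  also have "\<dots> \<le> (\<integral>\<^sup>+ j. emixed_norm q (g j) \<partial>count_space A)"
    unfolding emixed_norm_def using g(1) by (intro mixed_iter_Minkowski assms(1) q) auto
  also have "\<dots> \<le> (\<integral>\<^sup>+ j. emixed_norm q (G j) \<partial>count_space A)"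
  proof (rule nn_integral_mono)
    fix j assume "j \<in> space (count_space A)"
    then have "AE x in lebesgue. g j x \<le> G j x" using g(2)[of j] by auto
    then show "emixed_norm q (g j) \<le> emixed_norm q (G j)"
      by (rule emixed_norm_mono_AE[OF q0])
  qed
  finally show ?thesis .
qed

section \<open>Mixed norms on cubes: Hoelder and the norm of the indicator\<close>

abbreviation cube :: "real \<Rightarrow> (real ^ 'n) set" where
  "cube R \<equiv> cbox (vec (- R)) (vec R)"

lemma abs_le_iff_interval: "\<bar>x\<bar> \<le> R \<longleftrightarrow> - R \<le> x \<and> x \<le> (R :: real)"
  by linarith

lemma mem_cube: "x \<in> cube R \<longleftrightarrow> (\<forall>i. \<bar>x $ i\<bar> \<le> R)"
  by (simp add: mem_box_cart abs_le_iff_interval)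

lemma emeasure_cube:
  assumes "0 \<le> R"
  shows "emeasure lborel (cube R :: (real ^ 'n) set) = ennreal ((2 * R) powr real CARD('n))"
proof -
  have *: "(vec R - vec (- R)) \<bullet> b = 2 * R" if "b \<in> Basis" for b :: "real ^ 'n"
    using that by (auto simp: Basis_vec_def inner_axis)
  have "emeasure lborel (cube R :: (real ^ 'n) set) = ennreal (\<Prod>b\<in>(Basis :: (real ^ 'n) set). 2 * R)"
    using assms by (subst emeasure_lborel_cbox) (auto simp: * Basis_vec_def inner_axis)
  then show ?thesis using assms
    by (cases "R = 0") (auto simp: powr_realpow power_0_left)
qed

lemma nn_integral_Holder_interval:
  fixes g :: "real \<Rightarrow> ennreal"
  assumes [measurable]: "g \<in> borel_measurable borel" and "0 < R" "1 \<le> a"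
  shows "(\<integral>\<^sup>+ t. indicator {-R..R} t * g t \<partial>lborel)
    \<le> ennreal ((2 * R) powr (1 - 1 / a)) * epowr (\<integral>\<^sup>+ t. epowr (g t) a \<partial>lborel) (1 / a)"
proof -
  have "epowr (\<integral>\<^sup>+ t. indicator {-R..R} t * g t \<partial>lborel) a
      \<le> ennreal ((2 * R) powr (a - 1)) * (\<integral>\<^sup>+ t. indicator {-R..R} t * epowr (g t) a \<partial>lborel)"
    using assms by (intro epowr_nn_integral_Jensen) auto
  also have "\<dots> \<le> ennreal ((2 * R) powr (a - 1)) * (\<integral>\<^sup>+ t. epowr (g t) a \<partial>lborel)"
    by (intro mult_left_mono nn_integral_mono) (auto split: split_indicator)
  finally have "(\<integral>\<^sup>+ t. indicator {-R..R} t * g t \<partial>lborel)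
      \<le> epowr (ennreal ((2 * R) powr (a - 1)) * (\<integral>\<^sup>+ t. epowr (g t) a \<partial>lborel)) (1 / a)"
    using assms by (simp add: epowr_le_iff)
  also have "\<dots> = ennreal ((2 * R) powr (1 - 1 / a)) * epowr (\<integral>\<^sup>+ t. epowr (g t) a \<partial>lborel) (1 / a)"
    using assms by (simp add: epowr_mult epowr_ennreal powr_powr diff_divide_distrib)
  finally show ?thesis .
qed

text \<open>For \<open>y\<close> in the cube, the updated point is in the cube exactly when
  \<open>t\<close> is in the interval. After the swap the line variable is free and contributes the
  length \<open>2 * R\<close>. Thus one coordinate can be treated while the outer integral stays
  over the full cube.\<close>

lemma nn_integral_cube_average:
  fixes F :: "real ^ 'n \<Rightarrow> ennreal"
  assumes [measurable]: "F \<in> borel_measurable borel" and "0 < R"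
  shows "(\<integral>\<^sup>+ y. indicator (cube R) y * (\<integral>\<^sup>+ t. indicator {-R..R} t * F (upd_coord y i t) \<partial>lborel) \<partial>lborel)
    = ennreal (2 * R) * (\<integral>\<^sup>+ y. indicator (cube R) y * F y \<partial>lborel)"
proof -
  have upd: "indicator (cube R) y * indicator (cube R) (upd_coord y i t)
      = indicator (cube R) y * (indicator {-R..R} t :: ennreal)" for y :: "real ^ 'n" and t
    by (auto simp: mem_cube abs_le_iff_interval split: split_indicator)
  have "(\<integral>\<^sup>+ y. indicator (cube R) y * (\<integral>\<^sup>+ t. indicator {-R..R} t * F (upd_coord y i t) \<partial>lborel) \<partial>lborel)
    = (\<integral>\<^sup>+ y. \<integral>\<^sup>+ t. indicator (cube R) y * indicator (cube R) (upd_coord y i t) * F (upd_coord y i t) \<partial>lborel \<partial>lborel)"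
  proof (rule nn_integral_cong)
    fix y :: "real ^ 'n"
    have "indicator (cube R) y * (\<integral>\<^sup>+ t. indicator {-R..R} t * F (upd_coord y i t) \<partial>lborel)
        = (\<integral>\<^sup>+ t. indicator (cube R) y * (indicator {-R..R} t * F (upd_coord y i t)) \<partial>lborel)"
      by (rule nn_integral_cmult[symmetric]) measurable
    then show "indicator (cube R) y * (\<integral>\<^sup>+ t. indicator {-R..R} t * F (upd_coord y i t) \<partial>lborel)
        = (\<integral>\<^sup>+ t. indicator (cube R) y * indicator (cube R) (upd_coord y i t) * F (upd_coord y i t) \<partial>lborel)"
      by (simp only: upd mult.assoc)
  qed
  also have "\<dots> = (\<integral>\<^sup>+ y. \<integral>\<^sup>+ t. indicator (cube R) (upd_coord y i t) * indicator (cube R) y * F y \<partial>lborel \<partial>lborel)"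
    by (rule nn_integral_upd_coord_swap[where K="\<lambda>y z. indicator (cube R) y * indicator (cube R) z * F z"]) measurable
  also have "\<dots> = (\<integral>\<^sup>+ y. \<integral>\<^sup>+ t. indicator {-R..R} t * (indicator (cube R) y * F y) \<partial>lborel \<partial>lborel)"
  proof (intro nn_integral_cong)
    fix y t
    show "indicator (cube R) (upd_coord y i t) * indicator (cube R) y * F y
        = indicator {-R..R} t * (indicator (cube R) y * F y)"
      unfolding mult.commute[of "indicator (cube R) (upd_coord y i t)"] upd
      by (simp only: mult.assoc mult.left_commute)
  qed
  also have "\<dots> = (\<integral>\<^sup>+ y. ennreal (2 * R) * (indicator (cube R) y * F y) \<partial>lborel)"
    using assms by (simp add: nn_integral_multc)
  also have "\<dots> = ennreal (2 * R) * (\<integral>\<^sup>+ y. indicator (cube R) y * F y \<partial>lborel)"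
    by (rule nn_integral_cmult) measurable
  finally show ?thesis .
qed

text \<open>Each coordinate gives the Hoelder factor (2R)^(1 - 1/q_i), and dividing by the extra
  length 2R from \<open>nn_integral_cube_average\<close> leaves (2R)^(-1/q_i). The missing power
  (2R)^n appears only when the constant final iterate is integrated over the cube.\<close>

lemma mixed_iter_Holder_cube:
  fixes F :: "real ^ 'n \<Rightarrow> ennreal"
  assumes q: "\<And>i. 1 \<le> q $ i" and R: "0 < R" and "F \<in> borel_measurable borel" "0 < r"
  shows "(\<integral>\<^sup>+ y. indicator (cube R) y * epowr (F y) (1 / r) \<partial>lborel)
    \<le> ennreal ((2 * R) powr (- (\<Sum>i\<leftarrow>L. 1 / q $ i))) * (\<integral>\<^sup>+ y. indicator (cube R) y * mixed_iter q r L F y \<partial>lborel)"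
  using assms(3,4)
proof (induction L arbitrary: r F)
  case Nil
  then show ?case using R by simp
next
  case (Cons i L)
  note [measurable] = Cons.prems(1)
  have qi: "1 \<le> q $ i" by (rule q)
  define F' where "F' y = (\<integral>\<^sup>+ t. epowr (F (upd_coord y i t)) (q $ i / r) \<partial>lborel)" for y
  have [measurable]: "F' \<in> borel_measurable borel" unfolding F'_def by measurable
  define J where "J = (\<integral>\<^sup>+ y. indicator (cube R) y * epowr (F y) (1 / r) \<partial>lborel)"
  have "ennreal (2 * R) * J
      = (\<integral>\<^sup>+ y. indicator (cube R) y * (\<integral>\<^sup>+ t. indicator {-R..R} t * epowr (F (upd_coord y i t)) (1 / r) \<partial>lborel) \<partial>lborel)"
    unfolding J_def using R by (subst nn_integral_cube_average) simp_all
  also have "\<dots> \<le> (\<integral>\<^sup>+ y. indicator (cube R) y *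
      (ennreal ((2 * R) powr (1 - 1 / q $ i)) * epowr (F' y) (1 / q $ i)) \<partial>lborel)"
  proof (intro nn_integral_mono mult_left_mono)
    fix y
    show "(\<integral>\<^sup>+ t. indicator {-R..R} t * epowr (F (upd_coord y i t)) (1 / r) \<partial>lborel)
      \<le> ennreal ((2 * R) powr (1 - 1 / q $ i)) * epowr (F' y) (1 / q $ i)"
      using nn_integral_Holder_interval[of "\<lambda>t. epowr (F (upd_coord y i t)) (1 / r)", OF _ R qi]
      by (simp add: epowr_epowr F'_def)
  qed simp
  also have "\<dots> = ennreal ((2 * R) powr (1 - 1 / q $ i)) * (\<integral>\<^sup>+ y. indicator (cube R) y * epowr (F' y) (1 / q $ i) \<partial>lborel)"
    by (subst nn_integral_cmult[symmetric]) (simp_all add: mult_ac)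
  also have "\<dots> \<le> ennreal ((2 * R) powr (1 - 1 / q $ i)) * (ennreal ((2 * R) powr (- (\<Sum>i\<leftarrow>L. 1 / q $ i))) *
      (\<integral>\<^sup>+ y. indicator (cube R) y * mixed_iter q (q $ i) L F' y \<partial>lborel))"
    using qi by (intro mult_left_mono Cons.IH) auto
  finally have "ennreal (1 / (2 * R)) * (ennreal (2 * R) * J) \<le> ennreal (1 / (2 * R)) *
      (ennreal ((2 * R) powr (1 - 1 / q $ i)) * (ennreal ((2 * R) powr (- (\<Sum>i\<leftarrow>L. 1 / q $ i))) *
      (\<integral>\<^sup>+ y. indicator (cube R) y * mixed_iter q (q $ i) L F' y \<partial>lborel)))"
    by (rule mult_left_mono) simp
  also have "ennreal (1 / (2 * R)) * (ennreal (2 * R) * J) = J"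
    using R by (simp flip: ennreal_mult mult.assoc)
  also have "ennreal (1 / (2 * R)) *
      (ennreal ((2 * R) powr (1 - 1 / q $ i)) * (ennreal ((2 * R) powr (- (\<Sum>i\<leftarrow>L. 1 / q $ i))) *
      (\<integral>\<^sup>+ y. indicator (cube R) y * mixed_iter q (q $ i) L F' y \<partial>lborel)))
      = ennreal (1 / (2 * R) * (2 * R) powr (1 - 1 / q $ i) * (2 * R) powr (- (\<Sum>i\<leftarrow>L. 1 / q $ i))) *
      (\<integral>\<^sup>+ y. indicator (cube R) y * mixed_iter q (q $ i) L F' y \<partial>lborel)"
    using R by (simp only: ennreal_mult mult.assoc powr_ge_zero zero_le_divide_1_iff mult_nonneg_nonneg less_imp_le zero_le_numeral)
  also have "1 / (2 * R) * (2 * R) powr (1 - 1 / q $ i) * (2 * R) powr (- (\<Sum>i\<leftarrow>L. 1 / q $ i))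
      = (2 * R) powr (- (\<Sum>i\<leftarrow>i # L. 1 / q $ i))"
    using R by (simp add: powr_diff powr_minus powr_add field_simps)
  finally show ?case by (simp add: J_def F'_def mixed_iter_Cons_lborel)
qed

lemma emixed_norm_Holder_cube:
  fixes F :: "real ^ 'n::{finite,linorder} \<Rightarrow> ennreal"
  assumes q: "\<And>i. 1 \<le> q $ i" and R: "0 < R" and F: "F \<in> borel_measurable lebesgue"
  shows "(\<integral>\<^sup>+ y. indicator (cube R) y * F y \<partial>lebesgue)
    \<le> ennreal ((2 * R) powr (real CARD('n) - (\<Sum>i\<in>UNIV. 1 / q $ i))) * emixed_norm q F"
proof -
  have q0: "0 < q $ i" for i using q[of i] by linarith
  obtain G where G [measurable]: "G \<in> borel_measurable borel" and FG: "AE x in lborel. F x = G x"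
    using completion_ex_borel_measurable[OF F] by auto
  define S where "S = (\<Sum>i\<in>UNIV. 1 / q $ i)"
  have S: "(\<Sum>i\<leftarrow>sorted_list_of_set UNIV. 1 / q $ i) = S"
    by (simp add: S_def sum_list_distinct_conv_sum_set)
  have "(\<integral>\<^sup>+ y. indicator (cube R) y * F y \<partial>lebesgue) = (\<integral>\<^sup>+ y. indicator (cube R) y * G y \<partial>lborel)"
    unfolding nn_integral_completion by (rule nn_integral_cong_AE) (use FG in \<open>eventually_elim, simp\<close>)
  also have "\<dots> \<le> ennreal ((2 * R) powr (- S)) * (\<integral>\<^sup>+ y. indicator (cube R) (y :: real ^ 'n::{finite,linorder}) * emixed_norm q G \<partial>lborel)"
    using mixed_iter_Holder_cube[OF q R G, of 1 "sorted_list_of_set UNIV"]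
    by (simp add: S mixed_iter_eq_emixed_norm)
  also have "\<dots> = ennreal ((2 * R) powr (- S)) * (ennreal ((2 * R) powr real CARD('n)) * emixed_norm q G)"
    using R by (simp add: nn_integral_multc emeasure_cube)
  also have "\<dots> = ennreal ((2 * R) powr (real CARD('n) - S)) * emixed_norm q G"
    using R by (simp add: powr_diff powr_minus field_simps flip: ennreal_mult mult.assoc)
  also have "emixed_norm q G \<le> emixed_norm q F"
    using q0 by (rule emixed_norm_mono_AE) (use FG in \<open>auto simp: AE_completion_iff\<close>)
  finally show ?thesis by (simp add: S_def mult_left_mono)
qed

text \<open>The indicator constrains only the coordinates still in the list. Distinctness lets the
  update at \<open>i\<close> leave the other constraints alone, so the same shape of bound recurs
  with a new constant.\<close>

lemma mixed_iter_le_cube: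
  assumes q: "\<And>i. 0 < q $ i" and R: "0 < R" and "0 < r" "distinct L"
    and "\<And>y. F y \<le> c * indicator {y. \<forall>j\<in>set L. \<bar>y $ j\<bar> \<le> R} y"
  shows "mixed_iter q r L F y \<le> epowr c (1 / r) * ennreal ((2 * R) powr (\<Sum>i\<leftarrow>L. 1 / q $ i))"
  using assms(3-)
proof (induction L arbitrary: r F c)
  case Nil
  then show ?case using R by (auto intro: epowr_mono)
next
  case (Cons i L)
  have qi: "0 < q $ i" by (rule q)
  \<comment> \<open>The \<open>q $ i / r\<close>-th power of \<open>c\<close> integrated over an
    interval of length \<open>2 * R\<close>; its \<open>1 / q $ i\<close>-th root splits off one
    factor (2R)^(1/q_i).\<close>
  define c' where "c' = epowr c (q $ i / r) * ennreal (2 * R)"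
  have F': "(\<integral>\<^sup>+ t. epowr (F (upd_coord y i t)) (q $ i / r) \<partial>lborel)
      \<le> c' * indicator {y. \<forall>j\<in>set L. \<bar>y $ j\<bar> \<le> R} y" for y
  proof -
    have "(\<integral>\<^sup>+ t. epowr (F (upd_coord y i t)) (q $ i / r) \<partial>lborel) \<le>
        (\<integral>\<^sup>+ t. epowr c (q $ i / r) * indicator {y. \<forall>j\<in>set L. \<bar>y $ j\<bar> \<le> R} y * indicator {-R..R} t \<partial>lborel)"
    proof (rule nn_integral_mono)
      fix t
      have *: "{y. \<forall>j\<in>set (i # L). \<bar>y $ j\<bar> \<le> R} = {y. \<bar>y $ i\<bar> \<le> R \<and> (\<forall>j\<in>set L. \<bar>y $ j\<bar> \<le> R)}"
        by auto
      have "epowr (F (upd_coord y i t)) (q $ i / r) \<le>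
          epowr (c * indicator {y. \<forall>j\<in>set (i # L). \<bar>y $ j\<bar> \<le> R} (upd_coord y i t)) (q $ i / r)"
        using qi Cons.prems(1) by (intro epowr_mono Cons.prems(3)) simp
      also have "\<dots> = epowr c (q $ i / r) * indicator {y. \<forall>j\<in>set L. \<bar>y $ j\<bar> \<le> R} y * indicator {-R..R} t"
        unfolding * using Cons.prems(2)
        by (auto simp: abs_le_iff_interval split: split_indicator)
      finally show "epowr (F (upd_coord y i t)) (q $ i / r)
        \<le> epowr c (q $ i / r) * indicator {y. \<forall>j\<in>set L. \<bar>y $ j\<bar> \<le> R} y * indicator {-R..R} t" .
    qed
    also have "\<dots> = c' * indicator {y. \<forall>j\<in>set L. \<bar>y $ j\<bar> \<le> R} y"
      using R by (subst nn_integral_cmult) (simp_all add: c'_def mult_ac)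
    finally show ?thesis .
  qed
  have "mixed_iter q r (i # L) F y \<le> epowr c' (1 / q $ i) * ennreal ((2 * R) powr (\<Sum>i\<leftarrow>L. 1 / q $ i))"
    unfolding mixed_iter_Cons_lborel using Cons.prems(2) qi by (intro Cons.IH F') auto
  also have "epowr c' (1 / q $ i) = epowr c (1 / r) * ennreal ((2 * R) powr (1 / q $ i))"
    using R qi by (simp add: c'_def epowr_mult epowr_epowr epowr_ennreal)
  also have "\<dots> * ennreal ((2 * R) powr (\<Sum>i\<leftarrow>L. 1 / q $ i))
      = epowr c (1 / r) * ennreal ((2 * R) powr (\<Sum>i\<leftarrow>i # L. 1 / q $ i))"
    by (simp add: powr_add mult.assoc ennreal_mult)
  finally show ?case .
qed

lemma emixed_norm_le_cube:
  fixes F :: "real ^ 'n::{finite,linorder} \<Rightarrow> ennreal"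
  assumes q: "\<And>i. 0 < q $ i" and R: "0 < R" and F: "AE y in lebesgue. F y \<le> c * indicator (cube R) y"
  shows "emixed_norm q F \<le> c * ennreal ((2 * R) powr (\<Sum>i\<in>UNIV. 1 / q $ i))"
proof -
  have "emixed_norm q F \<le> emixed_norm q (\<lambda>y. c * indicator (cube R) y)"
    using q F by (rule emixed_norm_mono_AE)
  also have "\<dots> \<le> epowr c (1 / 1) * ennreal ((2 * R) powr (\<Sum>i\<leftarrow>sorted_list_of_set UNIV. 1 / q $ i))"
    unfolding emixed_norm_def
    by (rule mixed_iter_le_cube[OF q R]) (auto simp: mem_cube split: split_indicator)
  finally show ?thesis by (simp add: sum_list_distinct_conv_sum_set)
qed

section \<open>Morrey sequence norms\<close>

definition lp_norm :: "ennreal \<Rightarrow> 'b set \<Rightarrow> ('b \<Rightarrow> ennreal) \<Rightarrow> ennreal" where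
  "lp_norm p A v = (if p = \<infinity> then SUP k\<in>A. v k
     else epowr (\<integral>\<^sup>+ k. epowr (v k) (enn2real p) \<partial>count_space A) (1 / enn2real p))"

text \<open>By \<open>herz_morrey_norm_eq\<close>, the Herz-Morrey norm is this norm of the sequence
  of mixed norms on annuli weighted by 2^(k \<alpha>). With the weight inside the sequence, \<alpha>
  disappears from the sequence estimates.\<close>

definition morrey_norm :: "real \<Rightarrow> ennreal \<Rightarrow> (int \<Rightarrow> ennreal) \<Rightarrow> ennreal" where
  "morrey_norm lam p v = (SUP k0. ennreal (2 powr (- real_of_int k0 * lam)) * lp_norm p {..k0} v)"

text \<open>For finite exponents this is subadditivity of the power \<open>P / P' \<le> 1\<close>,
  applied to the \<open>P'\<close>-th powers of the terms.\<close>

lemma lp_norm_antimono: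
  assumes "0 < p" "p \<le> p'"
  shows "lp_norm p' A v \<le> lp_norm p A v"
proof (cases "p = \<infinity>")
  case True
  then show ?thesis using assms by (simp add: top_unique)
next
  case False
  then obtain P where P: "p = ennreal P" "0 < P"
    using assms(1) by (cases p) auto
  show ?thesis
  proof (cases "p' = \<infinity>")
    case True
    have "v k \<le> epowr (\<integral>\<^sup>+ k. epowr (v k) P \<partial>count_space A) (1 / P)" if "k \<in> A" for k
      using P nn_integral_ge_point[OF that, of "\<lambda>k. epowr (v k) P"] by (simp add: epowr_le_iff)
    then show ?thesis using P True by (auto simp: lp_norm_def intro: SUP_least)
  next
    case False
    then obtain P' where P': "p' = ennreal P'" "P \<le> P'"
      using assms(2) P by (cases p') auto
    have "epowr (\<integral>\<^sup>+ k. epowr (v k) P' \<partial>count_space A) (P / P')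
        \<le> (\<integral>\<^sup>+ k. epowr (epowr (v k) P') (P / P') \<partial>count_space A)"
      using P P' by (intro epowr_sum_subadditive) auto
    also have "\<dots> = (\<integral>\<^sup>+ k. epowr (v k) P \<partial>count_space A)"
      using P P' by (simp add: epowr_epowr)
    finally have "epowr (epowr (\<integral>\<^sup>+ k. epowr (v k) P' \<partial>count_space A) (P / P')) (1 / P)
        \<le> epowr (\<integral>\<^sup>+ k. epowr (v k) P \<partial>count_space A) (1 / P)"
      using P by (intro epowr_mono) auto
    then show ?thesis using P P' by (simp add: epowr_epowr lp_norm_def)
  qed
qed

lemma morrey_norm_antimono:
  assumes "0 < p" "p \<le> p'"
  shows "morrey_norm lam p' v \<le> morrey_norm lam p v"
  unfolding morrey_norm_def using lp_norm_antimono[OF assms] by (intro SUP_mono' mult_left_mono) auto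

lemma ennreal_powr_minus_mult_le_iff:
  "ennreal (2 powr (- a)) * x \<le> y \<longleftrightarrow> x \<le> ennreal (2 powr a) * y"
proof
  have inv: "ennreal (2 powr a) * (ennreal (2 powr (- a)) * z) = z"
    "ennreal (2 powr (- a)) * (ennreal (2 powr a) * z) = z" for z
    by (simp_all flip: ennreal_mult mult.assoc powr_add)
  show "ennreal (2 powr (- a)) * x \<le> y \<Longrightarrow> x \<le> ennreal (2 powr a) * y"
    using mult_left_mono[of "ennreal (2 powr (- a)) * x" y "ennreal (2 powr a)"] by (simp add: inv)
  show "x \<le> ennreal (2 powr a) * y \<Longrightarrow> ennreal (2 powr (- a)) * x \<le> y"
    using mult_left_mono[of x "ennreal (2 powr a) * y" "ennreal (2 powr (- a))"] by (simp add: inv)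
qed

lemma morrey_norm_le_iff:
  "morrey_norm lam p v \<le> X \<longleftrightarrow> (\<forall>k0. lp_norm p {..k0} v \<le> ennreal (2 powr (real_of_int k0 * lam)) * X)"
  unfolding morrey_norm_def SUP_le_iff
  using ennreal_powr_minus_mult_le_iff[of "real_of_int _ * lam"] by simp

lemma lp_norm_le_morrey_norm:
  "lp_norm p {..k0} v \<le> ennreal (2 powr (real_of_int k0 * lam)) * morrey_norm lam p v"
  using morrey_norm_le_iff[of lam p v "morrey_norm lam p v"] by simp

lemma le_lp_norm:
  assumes "0 < p" "k \<in> A"
  shows "v k \<le> lp_norm p A v"
proof -
  have "v k \<le> lp_norm \<infinity> A v" using assms(2) by (auto simp: lp_norm_def intro: SUP_upper)
  also have "\<dots> \<le> lp_norm p A v" using assms(1) by (intro lp_norm_antimono) auto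
  finally show ?thesis .
qed

section \<open>Convolution with exponentially decaying kernels\<close>

lemma nn_integral_exp_decay_finite:
  fixes \<delta> :: real
  assumes "0 < \<delta>"
  obtains H where "0 < H" "(\<integral>\<^sup>+ m. ennreal (2 powr (- \<delta> * \<bar>real_of_int m\<bar>)) \<partial>count_space UNIV) = ennreal H"
proof -
  define h where "h m = ennreal (2 powr (- \<delta> * \<bar>real_of_int m\<bar>))" for m
  define r where "r = (2::real) powr (- \<delta>)"
  have r: "0 < r" "r < 1" using assms by (auto simp: r_def powr_less_one)
  have h: "h (int n) = ennreal (r ^ n)" "h (- int n) = ennreal (r ^ n)" for n
    by (simp_all add: h_def r_def powr_powr flip: powr_realpow)
  \<comment> \<open>Two geometric series; they overlap at 0, which is counted twice in the upper
    bound.\<close>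
  have range: "(UNIV :: int set) = range int \<union> range (\<lambda>n. - int n)"
    by (metis (no_types, lifting) UNIV_I UNIV_eq_I Un_iff int_cases2 rangeI)
  have geo: "(\<integral>\<^sup>+ n. ennreal (r ^ n) \<partial>count_space UNIV) = ennreal (\<Sum>n. r ^ n)"
    using r by (simp add: nn_integral_count_space_nat suminf_ennreal2 summable_geometric)
  have "(\<integral>\<^sup>+ m. h m \<partial>count_space UNIV) \<le>
      (\<integral>\<^sup>+ m. h m * indicator (range int) m + h m * indicator (range (\<lambda>n. - int n)) m \<partial>count_space UNIV)"
    using range by (intro nn_integral_mono) (auto split: split_indicator)
  also have "\<dots> = (\<integral>\<^sup>+ m. h m \<partial>count_space (range int)) + (\<integral>\<^sup>+ m. h m \<partial>count_space (range (\<lambda>n. - int n)))"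
    by (simp add: nn_integral_add nn_integral_count_space_indicator)
  also have "\<dots> = (\<integral>\<^sup>+ n. h (int n) \<partial>count_space UNIV) + (\<integral>\<^sup>+ n. h (- int n) \<partial>count_space UNIV)"
    by (simp add: nn_integral_bij_count_space[of int UNIV "range int" h, symmetric]
        nn_integral_bij_count_space[of "\<lambda>n. - int n" UNIV "range (\<lambda>n. - int n)" h, symmetric] bij_betw_def inj_on_def)
  also have "\<dots> < top" by (simp add: h geo)
  finally obtain H where H: "(\<integral>\<^sup>+ m. h m \<partial>count_space UNIV) = ennreal H" "0 \<le> H"
    by (cases "\<integral>\<^sup>+ m. h m \<partial>count_space UNIV") auto
  \<comment> \<open>The term at 0 makes \<open>H\<close> positive, as Jensen requires of the total
    weight.\<close>
  have "h 0 \<le> (\<integral>\<^sup>+ m. h m \<partial>count_space UNIV)" by (rule nn_integral_ge_point) simp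
  then have "0 < H" using H by (auto simp: h_def)
  with H that show ?thesis by (simp add: h_def)
qed

text \<open>Gives \<open>P \<ge> 1\<close> and \<open>P < 1\<close> a common form. In the first case
  Jensen multiplies the kernel by H^(P-1); in the second, subadditivity replaces it by its
  \<open>P\<close>-th power, which decays at rate \<open>\<delta> * P\<close> and is still
  summable.\<close>

lemma epowr_exp_decay_sum_le:
  fixes \<delta> P :: real
  assumes "0 < \<delta>" "0 < P"
  obtains G :: real and g :: "int \<Rightarrow> ennreal"
  where "0 \<le> G" "(\<integral>\<^sup>+ m. g m \<partial>count_space UNIV) = ennreal G"
    "\<forall>x. epowr (\<integral>\<^sup>+ m. ennreal (2 powr (- \<delta> * \<bar>real_of_int m\<bar>)) * x m \<partial>count_space UNIV) P
      \<le> (\<integral>\<^sup>+ m. g m * epowr (x m) P \<partial>count_space UNIV)"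
proof (cases "1 \<le> P")
  case True
  obtain H where H: "0 < H" "(\<integral>\<^sup>+ m. ennreal (2 powr (- \<delta> * \<bar>real_of_int m\<bar>)) \<partial>count_space UNIV) = ennreal H"
    using nn_integral_exp_decay_finite[OF assms(1)] .
  show ?thesis
  proof (rule that[of "H powr (P - 1) * H"
        "\<lambda>m. ennreal (H powr (P - 1)) * ennreal (2 powr (- \<delta> * \<bar>real_of_int m\<bar>))"])
    show "(\<integral>\<^sup>+ m. ennreal (H powr (P - 1)) * ennreal (2 powr (- \<delta> * \<bar>real_of_int m\<bar>)) \<partial>count_space UNIV)
        = ennreal (H powr (P - 1) * H)"
      using H by (subst nn_integral_cmult) (simp_all add: ennreal_mult)
    show "\<forall>x. epowr (\<integral>\<^sup>+ m. ennreal (2 powr (- \<delta> * \<bar>real_of_int m\<bar>)) * x m \<partial>count_space UNIV) P \<le>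
        (\<integral>\<^sup>+ m. ennreal (H powr (P - 1)) * ennreal (2 powr (- \<delta> * \<bar>real_of_int m\<bar>)) * epowr (x m) P \<partial>count_space UNIV)"
      unfolding mult.assoc using H True
      by (subst nn_integral_cmult) (auto intro!: epowr_nn_integral_Jensen)
  qed (use H in simp)
next
  case False
  have *: "epowr (ennreal (2 powr (- \<delta> * \<bar>real_of_int m\<bar>))) P = ennreal (2 powr (- (\<delta> * P) * \<bar>real_of_int m\<bar>))" for m
    by (simp add: epowr_ennreal powr_powr mult_ac)
  obtain G where G: "0 < G" "(\<integral>\<^sup>+ m. ennreal (2 powr (- (\<delta> * P) * \<bar>real_of_int m\<bar>)) \<partial>count_space UNIV) = ennreal G"
    using nn_integral_exp_decay_finite[of "\<delta> * P"] assms by auto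
  show ?thesis
  proof (rule that[of G "\<lambda>m. epowr (ennreal (2 powr (- \<delta> * \<bar>real_of_int m\<bar>))) P"])
    show "\<forall>x. epowr (\<integral>\<^sup>+ m. ennreal (2 powr (- \<delta> * \<bar>real_of_int m\<bar>)) * x m \<partial>count_space UNIV) P \<le>
        (\<integral>\<^sup>+ m. epowr (ennreal (2 powr (- \<delta> * \<bar>real_of_int m\<bar>))) P * epowr (x m) P \<partial>count_space UNIV)"
      unfolding epowr_mult[symmetric] using False assms(2) by (intro allI epowr_sum_subadditive) auto
    show "(\<integral>\<^sup>+ m. epowr (ennreal (2 powr (- \<delta> * \<bar>real_of_int m\<bar>))) P \<partial>count_space UNIV) = ennreal G"
      unfolding * by (rule G)
  qed (use G in simp)
qed

text \<open>Shifting a sequence by \<open>m\<close> multiplies its Morrey norm by \<open>2 powr (- m * lam)\<close>, so the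
  convolution kernel \<open>2 powr (- \<delta> * \<bar>m\<bar> + m * lam)\<close> acts like a summable one.\<close>

lemma morrey_norm_convolution:
  fixes \<delta> c lam :: real
  assumes "0 < p" "0 \<le> lam" "0 < \<delta>" "0 \<le> c"
  obtains C where "0 \<le> C" "\<forall>u v. (\<forall>k. u k \<le> ennreal c * (\<integral>\<^sup>+ j.
      ennreal (2 powr (- \<delta> * \<bar>real_of_int (k - j)\<bar>)) * (ennreal (2 powr (real_of_int (k - j) * lam)) * v j)
      \<partial>count_space UNIV)) \<longrightarrow> morrey_norm lam p u \<le> ennreal C * morrey_norm lam p v"
proof -
  define h where "h m = ennreal (2 powr (- \<delta> * \<bar>real_of_int m\<bar>))" for m
  have reindex: "(\<integral>\<^sup>+ j. f (k - j) j \<partial>count_space UNIV) = (\<integral>\<^sup>+ m. f m (k - m) \<partial>count_space UNIV)"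
    for f :: "int \<Rightarrow> int \<Rightarrow> ennreal" and k
  proof -
    have "bij (\<lambda>m. k - m)"
      by (rule bij_betw_byWitness[where f'="\<lambda>m. k - m"]) auto
    from nn_integral_bij_count_space[OF this, of "\<lambda>j. f (k - j) j"] show ?thesis by simp
  qed
  have pw: "ennreal (2 powr (real_of_int m * lam)) * (ennreal (2 powr (real_of_int (k - m) * lam)) * x)
      = ennreal (2 powr (real_of_int k * lam)) * x" for m k x
    by (simp add: algebra_simps flip: ennreal_mult mult.assoc powr_add)
  show ?thesis
  proof (cases "p = \<infinity>")
    case True
    obtain H where H: "0 < H" "(\<integral>\<^sup>+ m. h m \<partial>count_space UNIV) = ennreal H"
      using nn_integral_exp_decay_finite[OF assms(3)] unfolding h_def .
    have "morrey_norm lam p u \<le> ennreal (c * H) * morrey_norm lam p v"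
      if u: "\<forall>k. u k \<le> ennreal c * (\<integral>\<^sup>+ j. h (k - j) * (ennreal (2 powr (real_of_int (k - j) * lam)) * v j) \<partial>count_space UNIV)"
      for u v
      unfolding morrey_norm_le_iff
    proof
      fix k0 :: int
      define X where "X = morrey_norm lam p v"
      have v: "v j \<le> ennreal (2 powr (real_of_int j * lam)) * X" for j
        using le_lp_norm[OF assms(1), of j "{..j}" v] lp_norm_le_morrey_norm[of p j v lam]
        unfolding X_def by (meson atMost_iff order_refl order_trans)
      have "u k \<le> ennreal (2 powr (real_of_int k0 * lam)) * (ennreal (c * H) * X)" if "k \<le> k0" for k
      proof -
        have "u k \<le> ennreal c * (\<integral>\<^sup>+ m. h m * (ennreal (2 powr (real_of_int m * lam)) * v (k - m)) \<partial>count_space UNIV)"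
          using u[rule_format, of k] by (subst (asm) reindex[where f="\<lambda>m j. h m * (ennreal (2 powr (real_of_int m * lam)) * v j)"])
        also have "\<dots> \<le> ennreal c * (\<integral>\<^sup>+ m. h m * (ennreal (2 powr (real_of_int m * lam)) *
            (ennreal (2 powr (real_of_int (k - m) * lam)) * X)) \<partial>count_space UNIV)"
          by (rule mult_left_mono[OF nn_integral_mono[OF mult_left_mono[OF mult_left_mono[OF v]]]]) simp_all
        also have "\<dots> = ennreal c * (ennreal H * (ennreal (2 powr (real_of_int k * lam)) * X))"
          unfolding pw by (simp add: nn_integral_multc H)
        also have "\<dots> \<le> ennreal c * (ennreal H * (ennreal (2 powr (real_of_int k0 * lam)) * X))"
          using that assms(2) by (intro mult_left_mono mult_right_mono ennreal_leI powr_mono) auto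
        finally show ?thesis using assms(4) H by (simp add: ennreal_mult mult_ac)
      qed
      then show "lp_norm p {..k0} u \<le> ennreal (2 powr (real_of_int k0 * lam)) * (ennreal (c * H) * morrey_norm lam p v)"
        using True by (auto simp: lp_norm_def X_def intro: SUP_least)
    qed
    then show ?thesis using that[of "c * H"] assms(4) H by (simp add: h_def)
  next
    case False
    then obtain P where P: "p = ennreal P" "0 < P"
      using assms(1) by (cases p) auto
    obtain G and g :: "int \<Rightarrow> ennreal" where G: "0 \<le> G" "(\<integral>\<^sup>+ m. g m \<partial>count_space UNIV) = ennreal G"
      and g: "\<forall>x. epowr (\<integral>\<^sup>+ m. h m * x m \<partial>count_space UNIV) P \<le> (\<integral>\<^sup>+ m. g m * epowr (x m) P \<partial>count_space UNIV)"
      using epowr_exp_decay_sum_le[OF assms(3) P(2)] unfolding h_def .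
    have "morrey_norm lam p u \<le> ennreal (c * G powr (1 / P)) * morrey_norm lam p v"
      if u: "\<forall>k. u k \<le> ennreal c * (\<integral>\<^sup>+ j. h (k - j) * (ennreal (2 powr (real_of_int (k - j) * lam)) * v j) \<partial>count_space UNIV)"
      for u v
      unfolding morrey_norm_le_iff
    proof
      fix k0 :: int
      define X where "X = morrey_norm lam p v"
      have v: "(\<integral>\<^sup>+ k. epowr (v k) P \<partial>count_space {..i}) \<le> epowr (ennreal (2 powr (real_of_int i * lam)) * X) P" for i
        using lp_norm_le_morrey_norm[of p i v lam] P
        by (simp add: lp_norm_def X_def epowr_le_iff)
      \<comment> \<open>The segment up to \<open>k0\<close> is moved to \<open>k0 - m\<close>, where
        the Morrey norm allows 2^((k0-m) lam); the factor 2^(m lam) restores the level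
        \<open>k0\<close>. For negative \<open>m\<close> the new segment passes \<open>k0\<close>,
        so control of all segments is essential.\<close>
      have shift: "(\<integral>\<^sup>+ k. epowr (ennreal (2 powr (real_of_int m * lam)) * v (k - m)) P \<partial>count_space {..k0})
          \<le> epowr (ennreal (2 powr (real_of_int k0 * lam)) * X) P" for m
      proof -
        have "bij_betw (\<lambda>k. k - m) {..k0} {..k0 - m}"
          by (rule bij_betw_byWitness[where f'="\<lambda>k. k + m"]) auto
        then have "(\<integral>\<^sup>+ k. epowr (v (k - m)) P \<partial>count_space {..k0}) = (\<integral>\<^sup>+ k. epowr (v k) P \<partial>count_space {..k0 - m})"
          by (rule nn_integral_bij_count_space)
        then have "(\<integral>\<^sup>+ k. epowr (ennreal (2 powr (real_of_int m * lam)) * v (k - m)) P \<partial>count_space {..k0})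
            \<le> epowr (ennreal (2 powr (real_of_int m * lam))) P * epowr (ennreal (2 powr (real_of_int (k0 - m) * lam)) * X) P"
          using v[of "k0 - m"] by (simp only: epowr_mult nn_integral_cmult borel_measurable_count_space mult_left_mono zero_le)
        then show ?thesis by (simp only: pw epowr_mult[symmetric])
      qed
      have "(\<integral>\<^sup>+ k. epowr (u k) P \<partial>count_space {..k0})
        \<le> (\<integral>\<^sup>+ k. epowr (ennreal c) P * (\<integral>\<^sup>+ m. g m *
            epowr (ennreal (2 powr (real_of_int m * lam)) * v (k - m)) P \<partial>count_space UNIV) \<partial>count_space {..k0})"
      proof (rule nn_integral_mono)
        fix k
        have "u k \<le> ennreal c * (\<integral>\<^sup>+ m. h m * (ennreal (2 powr (real_of_int m * lam)) * v (k - m)) \<partial>count_space UNIV)"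
          using u[rule_format, of k] by (subst (asm) reindex[where f="\<lambda>m j. h m * (ennreal (2 powr (real_of_int m * lam)) * v j)"])
        then have "epowr (u k) P \<le> epowr (ennreal c *
            (\<integral>\<^sup>+ m. h m * (ennreal (2 powr (real_of_int m * lam)) * v (k - m)) \<partial>count_space UNIV)) P"
          using P(2) by (intro epowr_mono) auto
        also have "\<dots> \<le> epowr (ennreal c) P * (\<integral>\<^sup>+ m. g m *
            epowr (ennreal (2 powr (real_of_int m * lam)) * v (k - m)) P \<partial>count_space UNIV)"
          unfolding epowr_mult[of "ennreal c"] by (rule mult_left_mono[OF spec[OF g]]) simp
        finally show "epowr (u k) P \<le> epowr (ennreal c) P * (\<integral>\<^sup>+ m. g m *
            epowr (ennreal (2 powr (real_of_int m * lam)) * v (k - m)) P \<partial>count_space UNIV)" .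
      qed
      also have "\<dots> = epowr (ennreal c) P * (\<integral>\<^sup>+ m. g m *
          (\<integral>\<^sup>+ k. epowr (ennreal (2 powr (real_of_int m * lam)) * v (k - m)) P \<partial>count_space {..k0}) \<partial>count_space UNIV)"
        by (subst nn_integral_cmult, simp, subst nn_integral_count_space_nn_integral)
           (simp_all add: nn_integral_cmult)
      also have "\<dots> \<le> epowr (ennreal c) P * (\<integral>\<^sup>+ m. g m * epowr (ennreal (2 powr (real_of_int k0 * lam)) * X) P \<partial>count_space UNIV)"
        by (intro mult_left_mono nn_integral_mono shift) auto
      also have "\<dots> = epowr (ennreal c) P * (ennreal G * epowr (ennreal (2 powr (real_of_int k0 * lam)) * X) P)"
        by (simp add: nn_integral_multc G)
      also have "\<dots> = epowr (ennreal (2 powr (real_of_int k0 * lam)) * (ennreal (c * G powr (1 / P)) * X)) P"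
        using assms(4) G(1) P(2) by (simp add: epowr_mult epowr_ennreal powr_mult powr_powr ennreal_mult mult_ac)
      finally show "lp_norm p {..k0} u \<le> ennreal (2 powr (real_of_int k0 * lam)) * (ennreal (c * G powr (1 / P)) * morrey_norm lam p v)"
        using P by (simp add: lp_norm_def X_def flip: epowr_le_iff) (simp add: epowr_le_iff epowr_epowr)
    qed
    then show ?thesis using that[of "c * G powr (1 / P)"] assms(4) by (simp add: h_def)
  qed
qed

lemma herz_morrey_norm_eq:
  "herz_morrey_norm \<alpha> lam p q f =
    morrey_norm lam p (\<lambda>k. ennreal (2 powr (real_of_int k * \<alpha>)) * mixed_norm q (restr (annulus k) f))"
  unfolding herz_morrey_norm_def morrey_norm_def lp_norm_def
  by (cases "p = \<infinity>")
     (simp_all add: infsum_eq_nn_integral_count_space[OF countableI_type] epowr_mult epowr_ennreal powr_powr)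

section \<open>Dyadic decomposition\<close>

lemma ennreal_norm_restr: "ennreal (norm (restr A f x)) = indicator A x * ennreal (norm (f x))"
  by (simp add: restr_def split: split_indicator)

lemma mixed_norm_restr: "mixed_norm q (restr A f) = emixed_norm q (\<lambda>x. indicator A x * ennreal (norm (f x)))"
  by (simp add: mixed_norm_eq_emixed_norm ennreal_norm_restr)

lemma mixed_norm_restr_mono:
  assumes "\<And>i. 0 < q $ i" "A \<subseteq> B"
  shows "mixed_norm q (restr A f) \<le> mixed_norm q (restr B f)"
  unfolding mixed_norm_restr
  using assms(1) by (rule emixed_norm_mono_AE) (use assms(2) in \<open>auto split: split_indicator\<close>)

lemma borel_measurable_restr:
  fixes f :: "'b \<Rightarrow> 'a::{real_normed_vector,second_countable_topology}"
  assumes "A \<in> sets M" "f \<in> borel_measurable M"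
  shows "restr A f \<in> borel_measurable M"
  unfolding restr_def using assms by measurable

lemma mem_annulus: "x \<in> annulus k \<longleftrightarrow> 2 powr real_of_int (k - 1) < norm x \<and> norm x \<le> 2 powr real_of_int k"
  by (auto simp: annulus_def dyadic_ball_def)

lemma annulus_in_sets_lebesgue [measurable]: "(annulus k :: (real ^ 'n) set) \<in> sets lebesgue"
proof -
  have "dyadic_ball j = (cball 0 (2 powr real_of_int j) :: (real ^ 'n) set)" for j
    by (auto simp: dyadic_ball_def)
  then have "(annulus k :: (real ^ 'n) set) = cball 0 (2 powr real_of_int k) - cball 0 (2 powr real_of_int (k - 1))"
    unfolding annulus_def by metis
  then have "(annulus k :: (real ^ 'n) set) \<in> sets borel"
    by (metis borel_closed closed_cball sets.Diff)
  then show ?thesis by simp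
qed

lemma annulus_subset_cube: "annulus k \<subseteq> cube (2 powr real_of_int k)"
  by (auto simp: mem_annulus mem_cube intro: order_trans[OF component_le_norm_cart])

text \<open>The annulus omits its inner sphere; removing only the open inner ball puts that sphere
  back and yields a closed set.\<close>

lemma annulus_subset_compact:
  obtains K :: "(real ^ 'n) set" where "compact K" "K \<subseteq> UNIV - {0}" "annulus k \<subseteq> K"
proof
  let ?K = "cball 0 (2 powr real_of_int k) - ball 0 (2 powr real_of_int (k - 1)) :: (real ^ 'n) set"
  show "compact ?K" by (intro compact_diff) auto
  show "?K \<subseteq> UNIV - {0}" by auto
  show "annulus k \<subseteq> ?K" by (auto simp: mem_annulus)
qed

text \<open>On a nonempty \<open>K\<close> the norm attains a positive minimum and a maximum, which
  bound the annulus indices.\<close>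

lemma compact_subset_annuli:
  fixes K :: "(real ^ 'n) set"
  assumes "compact K" "K \<subseteq> UNIV - {0}"
  obtains a b :: int where "K \<subseteq> (\<Union>k\<in>{a..b}. annulus k)"
proof (cases "K = {}")
  case True
  then show ?thesis using that[of 0 0] by simp
next
  case False
  have cont: "continuous_on K norm" by (intro continuous_intros)
  obtain x0 where x0: "x0 \<in> K" "\<And>x. x \<in> K \<Longrightarrow> norm x0 \<le> norm x"
    using continuous_attains_inf[OF assms(1) False cont] by auto
  obtain x1 where x1: "x1 \<in> K" "\<And>x. x \<in> K \<Longrightarrow> norm x \<le> norm x1"
    using continuous_attains_sup[OF assms(1) False cont] by auto
  show ?thesis
  proof (rule that[of "\<lceil>log 2 (norm x0)\<rceil>" "\<lceil>log 2 (norm x1)\<rceil>"], rule subsetI)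
    fix x assume x: "x \<in> K"
    then have pos: "0 < norm x" "0 < norm x0" using x0(1) assms(2) by auto
    \<comment> \<open>The ceiling is the right rounding because an annulus contains its outer
      sphere.\<close>
    let ?k = "\<lceil>log 2 (norm x)\<rceil>"
    have "real_of_int (?k - 1) < log 2 (norm x)" by linarith
    then have "2 powr real_of_int (?k - 1) < norm x"
      using pos by (simp add: less_log_iff)
    moreover have "norm x \<le> 2 powr real_of_int ?k"
      using log_le_iff[of 2 "norm x" "real_of_int ?k"] pos by simp
    ultimately have "x \<in> annulus ?k" by (simp only: mem_annulus)
    moreover have "\<lceil>log 2 (norm x0)\<rceil> \<le> ?k" "?k \<le> \<lceil>log 2 (norm x1)\<rceil>"
      using x0(2)[OF x] x1(2)[OF x] pos by (auto intro!: ceiling_mono log_mono)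
    ultimately show "x \<in> (\<Union>k\<in>{\<lceil>log 2 (norm x0)\<rceil>..\<lceil>log 2 (norm x1)\<rceil>}. annulus k)" by auto
  qed
qed

section \<open>Dyadic pieces: integrability, summation and local membership\<close>

lemma restr_annulus_in_mixed_lebesgue:
  fixes f :: "real ^ 'n::{finite,linorder} \<Rightarrow> 'a::{real_normed_vector,second_countable_topology}"
  assumes "\<And>i. 0 < q $ i" "f \<in> mixed_lebesgue_loc_punctured q"
  shows "restr (annulus k) f \<in> mixed_lebesgue q"
proof -
  obtain K :: "(real ^ 'n::{finite,linorder}) set" where "compact K" "K \<subseteq> UNIV - {0}" and K: "annulus k \<subseteq> K"
    using annulus_subset_compact .
  then have "mixed_norm q (restr K f) < \<infinity>" "f \<in> borel_measurable lebesgue"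
    using assms(2) by (auto simp: mixed_lebesgue_loc_punctured_def mixed_lebesgue_def)
  moreover have "mixed_norm q (restr (annulus k) f) \<le> mixed_norm q (restr K f)"
    using assms(1) K by (rule mixed_norm_restr_mono)
  ultimately show ?thesis
    by (auto simp: mixed_lebesgue_def intro: borel_measurable_restr le_less_trans)
qed

lemma restr_annulus_integrable:
  fixes f :: "real ^ 'n::{finite,linorder} \<Rightarrow> 'a::euclidean_space"
  assumes q: "\<And>i. 1 \<le> q $ i" and g: "restr (annulus k) f \<in> mixed_lebesgue q"
  shows "restr (annulus k) f \<in> L1_supported_in (annulus k)"
    and "ennreal (LINT y|lebesgue. norm (restr (annulus k) f y))
      \<le> ennreal (2 powr (real_of_int (k + 1) * (real CARD('n) - (\<Sum>i\<in>UNIV. 1 / q $ i)))) *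
        mixed_norm q (restr (annulus k) f)"
proof -
  define g where "g = restr (annulus k) f"
  have meas: "g \<in> borel_measurable lebesgue" and fin: "mixed_norm q g < \<infinity>"
    using g by (auto simp: mixed_lebesgue_def g_def)
  have "(\<integral>\<^sup>+ y. ennreal (norm (g y)) \<partial>lebesgue)
      = (\<integral>\<^sup>+ y. indicator (cube (2 powr real_of_int k)) y * ennreal (norm (g y)) \<partial>lebesgue)"
    using annulus_subset_cube[of k]
    by (intro nn_integral_cong) (auto simp: g_def ennreal_norm_restr split: split_indicator)
  also have "\<dots> \<le> ennreal ((2 * 2 powr real_of_int k) powr (real CARD('n) - (\<Sum>i\<in>UNIV. 1 / q $ i))) * mixed_norm q g"
    unfolding mixed_norm_eq_emixed_norm using meas by (intro emixed_norm_Holder_cube q) auto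
  \<comment> \<open>The cube with half side 2^k has side 2^(k+1), whence the index
    \<open>k + 1\<close> in this and later estimates.\<close>
  also have "2 * 2 powr real_of_int k = 2 powr real_of_int (k + 1)"
    by (simp add: powr_add)
  finally have le: "(\<integral>\<^sup>+ y. ennreal (norm (g y)) \<partial>lebesgue)
      \<le> ennreal (2 powr (real_of_int (k + 1) * (real CARD('n) - (\<Sum>i\<in>UNIV. 1 / q $ i)))) * mixed_norm q g"
    by (simp add: powr_powr)
  also have "\<dots> < \<infinity>" using fin by (simp add: ennreal_mult_less_top)
  finally have int: "integrable lebesgue g"
    using meas by (intro integrableI_bounded) auto
  then show "restr (annulus k) f \<in> L1_supported_in (annulus k)"
    by (simp add: L1_supported_in_def g_def restr_def)
  show "ennreal (LINT y|lebesgue. norm (restr (annulus k) f y))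
      \<le> ennreal (2 powr (real_of_int (k + 1) * (real CARD('n) - (\<Sum>i\<in>UNIV. 1 / q $ i)))) *
        mixed_norm q (restr (annulus k) f)"
    using le int by (simp add: g_def[symmetric] nn_integral_eq_integral)
qed

lemma emixed_norm_annulus_le:
  fixes F :: "real ^ 'n::{finite,linorder} \<Rightarrow> ennreal"
  assumes "\<And>i. 0 < q $ i" "AE x in lebesgue. x \<in> annulus k \<longrightarrow> F x \<le> c"
  shows "emixed_norm q (\<lambda>x. indicator (annulus k) x * F x)
    \<le> c * ennreal (2 powr (real_of_int (k + 1) * (\<Sum>i\<in>UNIV. 1 / q $ i)))"
proof -
  have "emixed_norm q (\<lambda>x. indicator (annulus k) x * F x) \<le> c * ennreal ((2 * 2 powr real_of_int k) powr (\<Sum>i\<in>UNIV. 1 / q $ i))"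
  proof (rule emixed_norm_le_cube[OF assms(1)])
    show "AE x in lebesgue. indicator (annulus k) x * F x \<le> c * indicator (cube (2 powr real_of_int k)) x"
      using assms(2) by eventually_elim (use annulus_subset_cube[of k] in \<open>auto split: split_indicator\<close>)
  qed simp
  also have "2 * 2 powr real_of_int k = 2 powr real_of_int (k + 1)"
    by (simp add: powr_add)
  finally show ?thesis by (simp add: powr_powr)
qed

lemma sublinear_operator_on_measurable:
  "sublinear_operator_on D T \<Longrightarrow> f \<in> D \<Longrightarrow> T f \<in> borel_measurable lebesgue"
  by (simp add: sublinear_operator_on_def)

lemma mixed_norm_annulus_le_sum:
  fixes T :: "(real ^ 'n::{finite,linorder} \<Rightarrow> 'a::{real_normed_field,euclidean_space}) \<Rightarrow> (real ^ 'n::{finite,linorder} \<Rightarrow> 'a)"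
  assumes q: "\<And>i. 1 \<le> q $ i" and "dyadically_subadditive_at T f"
    and "\<And>j. T (restr (annulus j) f) \<in> borel_measurable lebesgue"
  shows "mixed_norm q (restr (annulus k) (T f)) \<le>
    (\<integral>\<^sup>+ j. mixed_norm q (restr (annulus k) (T (restr (annulus j) f))) \<partial>count_space UNIV)"
proof -
  have q0: "0 < q $ i" for i using q[of i] by linarith
  have "mixed_norm q (restr (annulus k) (T f)) \<le>
      emixed_norm q (\<lambda>x. \<integral>\<^sup>+ j. indicator (annulus k) x * ennreal (norm (T (restr (annulus j) f) x)) \<partial>count_space UNIV)"
    unfolding mixed_norm_restr using q0
  proof (rule emixed_norm_mono_AE)
    show "AE x in lebesgue. indicator (annulus k) x * ennreal (norm (T f x)) \<le>
        (\<integral>\<^sup>+ j. indicator (annulus k) x * ennreal (norm (T (restr (annulus j) f) x)) \<partial>count_space UNIV)"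
      using assms(2) unfolding dyadically_subadditive_at_def
      by eventually_elim (simp add: infsum_eq_nn_integral_count_space[OF countableI_type] nn_integral_cmult mult_left_mono)
  qed
  also have "\<dots> \<le> (\<integral>\<^sup>+ j. mixed_norm q (restr (annulus k) (T (restr (annulus j) f))) \<partial>count_space UNIV)"
    unfolding mixed_norm_restr using assms(3) by (intro emixed_norm_Minkowski q) auto
  finally show ?thesis .
qed

text \<open>A compact set avoiding the origin is covered by finitely many annuli, so Minkowski gives
  a finite sum of finite norms.\<close>

lemma mixed_lebesgue_loc_puncturedI:
  fixes f :: "real ^ 'n::{finite,linorder} \<Rightarrow> 'a::{real_normed_vector,second_countable_topology}"
  assumes q: "\<And>i. 1 \<le> q $ i" and f: "f \<in> borel_measurable lebesgue"
    and fin: "\<And>k. mixed_norm q (restr (annulus k) f) < \<infinity>"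
  shows "f \<in> mixed_lebesgue_loc_punctured q"
proof -
  have q0: "0 < q $ i" for i using q[of i] by linarith
  have "restr K f \<in> mixed_lebesgue q" if K: "compact K" "K \<subseteq> UNIV - {0}" for K
  proof -
    obtain a b :: int where ab: "K \<subseteq> (\<Union>k\<in>{a..b}. annulus k)"
      using compact_subset_annuli[OF K] .
    have "mixed_norm q (restr K f) \<le>
        emixed_norm q (\<lambda>x. \<integral>\<^sup>+ k. indicator (annulus k) x * ennreal (norm (f x)) \<partial>count_space {a..b})"
      unfolding mixed_norm_restr using q0
    proof (rule emixed_norm_mono_AE, intro AE_I2)
      fix x
      show "indicator K x * ennreal (norm (f x)) \<le> (\<integral>\<^sup>+ k. indicator (annulus k) x * ennreal (norm (f x)) \<partial>count_space {a..b})"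
      proof (cases "x \<in> K")
        case True
        with ab obtain k where "k \<in> {a..b}" "x \<in> annulus k" by auto
        then show ?thesis
          using True nn_integral_ge_point[of k "{a..b}" "\<lambda>k. indicator (annulus k) x * ennreal (norm (f x))"] by simp
      qed simp
    qed
    also have "\<dots> \<le> (\<integral>\<^sup>+ k. mixed_norm q (restr (annulus k) f) \<partial>count_space {a..b})"
      unfolding mixed_norm_restr using f by (intro emixed_norm_Minkowski q) auto
    also have "\<dots> < \<infinity>"
      using fin by (simp add: nn_integral_count_space_finite)
    finally show ?thesis
      using f K(1) by (auto simp: mixed_lebesgue_def intro!: borel_measurable_restr dest: compact_imp_closed)
  qed
  then show ?thesis using f by (auto simp: mixed_lebesgue_loc_punctured_def)
qed

lemma herz_morrey_norm_finite_imp: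
  assumes "0 < p" "herz_morrey_norm \<alpha> lam p q f < \<infinity>"
  shows "mixed_norm q (restr (annulus k) f) < \<infinity>"
proof -
  define v where "v k = ennreal (2 powr (real_of_int k * \<alpha>)) * mixed_norm q (restr (annulus k) f)" for k
  have "v k \<le> lp_norm p {..k} v" using assms(1) by (rule le_lp_norm) simp
  also have "\<dots> \<le> ennreal (2 powr (real_of_int k * lam)) * morrey_norm lam p v"
    by (rule lp_norm_le_morrey_norm)
  also have "\<dots> < \<infinity>"
    using assms(2) by (simp add: herz_morrey_norm_eq v_def[abs_def] ennreal_mult_less_top)
  finally show ?thesis by (auto simp: v_def ennreal_mult_less_top)
qed

section \<open>The kernel bound for a single piece, and summation over the pieces\<close>

theorem theorem3p2:
  fixes l \<alpha> lam :: real
    and p1 p2 :: ennreal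
    and q1 q2 :: "real ^ 'n::{finite,linorder}"
    and D :: "(real ^ 'n::{finite,linorder} \<Rightarrow> 'a::{real_normed_field,euclidean_space}) set"
    and I :: "(real ^ 'n::{finite,linorder} \<Rightarrow> 'a) \<Rightarrow> (real ^ 'n::{finite,linorder} \<Rightarrow> 'a)"
  assumes l_range: "0 < l" "l < real CARD('n)"
    and lambda: "0 \<le> lam"
    and p: "0 < p1" "p1 \<le> p2"
    and q1: "\<And>i. 1 < q1 $ i \<and> q1 $ i < 1 / l"
    and q2: "\<And>i. 1 \<le> q2 $ i"
    and l_eq: "l = (\<Sum>i\<in>UNIV. 1 / q1 $ i) - (\<Sum>i\<in>UNIV. 1 / q2 $ i)"
    and alpha: "lam - (\<Sum>i\<in>UNIV. 1 / q2 $ i) < \<alpha>"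
               "\<alpha> < real CARD('n) - (\<Sum>i\<in>UNIV. 1 / q1 $ i)"
    and domain: "mixed_lebesgue q1 \<subseteq> D"
                "\<And>j. L1_supported_in (annulus j) \<subseteq> D"
                "herz_morrey \<alpha> lam p1 q1 \<subseteq> D"
    and sublinear: "sublinear_operator_on D I"
    and dyadic: "\<And>f. f \<in> herz_morrey \<alpha> lam p1 q1 \<Longrightarrow> dyadically_subadditive_at I f"
    and bounded: "bounded_operator (mixed_norm q1) (mixed_lebesgue q1)
                    (mixed_norm q2) (mixed_lebesgue q2) I"
    and size_far: "\<exists>C. \<forall>j::int. \<forall>f\<in>L1_supported_in (annulus j). AE x in lebesgue.
           2 powr (real_of_int j + 1) \<le> norm x \<longrightarrow>
           norm (I f x) \<le> C * (LINT y|lebesgue. norm (f y)) * norm x powr (- (real CARD('n) - l))"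
    and size_near: "\<exists>C. \<forall>j::int. \<forall>f\<in>L1_supported_in (annulus j). AE x in lebesgue.
           norm x \<le> 2 powr (real_of_int j - 2) \<longrightarrow>
           norm (I f x) \<le> C * (LINT y|lebesgue. norm (f y)) * 2 powr (- (real_of_int j * (real CARD('n) - l)))"
  shows "bounded_operator (herz_morrey_norm \<alpha> lam p1 q1) (herz_morrey \<alpha> lam p1 q1)
           (herz_morrey_norm \<alpha> lam p2 q2) (herz_morrey \<alpha> lam p2 q2) I"
proof -
  define A where "A = real CARD('n) - (\<Sum>i\<in>UNIV. 1 / q1 $ i)"
  define B where "B = (\<Sum>i\<in>UNIV. 1 / q2 $ i)"
  have AB: "real CARD('n) - l = A + B" using l_eq by (simp add: A_def B_def)
  \<comment> \<open>Makes |x|^(-(A+B)) decreasing, so that |x| can be replaced by its lower bound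
    2^(k-1) on the annulus.\<close>
  have AB_pos: "0 < A + B" using AB l_range by simp
  \<comment> \<open>The smaller of the two gaps in the hypothesis on \<alpha>: the first governs j
    \<le> k, the second j \<ge> k.\<close>
  define \<delta> where "\<delta> = min (A - \<alpha>) (B + \<alpha> - lam)"
  have \<delta>: "0 < \<delta>" "\<delta> \<le> A - \<alpha>" "\<delta> \<le> B + \<alpha> - lam"
    using alpha by (auto simp: \<delta>_def A_def B_def)
  have q1': "1 \<le> q1 $ i" "0 < q1 $ i" and q2': "0 < q2 $ i" for i
    using q1[of i] q2[of i] by auto
  \<comment> \<open>The factor 2^(-(k-j) \<alpha>) is cancelled by the weights 2^(k \<alpha>) and
    2^(j \<alpha>), leaving exactly the kernel of \<open>morrey_norm_convolution\<close>.\<close>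
  define w where "w k j = 2 powr (- \<delta> * \<bar>real_of_int (k - j)\<bar>) * 2 powr (real_of_int (k - j) * (lam - \<alpha>))" for k j :: int
  have w_far: "2 powr (- (real_of_int (k - j) * A)) \<le> w k j" if "j \<le> k" for k j
  proof -
    have "real_of_int (k - j) * (\<delta> + \<alpha> - lam) \<le> real_of_int (k - j) * A"
      using \<delta> lambda that by (intro mult_left_mono) auto
    then show ?thesis using that by (auto simp: w_def algebra_simps simp flip: powr_add)
  qed
  have w_near: "2 powr (real_of_int (k - j) * B) \<le> w k j" if "k \<le> j" for k j
  proof -
    have "real_of_int (j - k) * (\<delta> + lam - \<alpha>) \<le> real_of_int (j - k) * B"
      using \<delta> that by (intro mult_left_mono) auto
    then show ?thesis using that by (auto simp: w_def algebra_simps simp flip: powr_add)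
  qed
  \<comment> \<open>For |k - j| \<le> 1 the weight \<open>w k j\<close> is at least the inverse of
    \<open>E\<close>, so bounded diagonal terms fit the same kernel.\<close>
  define E where "E = 2 powr (\<delta> + \<bar>lam - \<alpha>\<bar>)"
  have w_local: "1 \<le> E * w k j" if kj: "\<bar>k - j\<bar> \<le> 1" for k j
  proof -
    consider "k - j = -1" | "k - j = 0" | "k - j = 1" using kj by linarith
    then have "0 \<le> \<delta> + \<bar>lam - \<alpha>\<bar> + (- \<delta> * \<bar>real_of_int (k - j)\<bar>) + real_of_int (k - j) * (lam - \<alpha>)"
      using \<delta> by cases auto
    then show ?thesis
      unfolding w_def E_def by (simp only: powr_add[symmetric] mult.assoc[symmetric] ge_one_powr_ge_zero one_le_numeral)
  qed
  obtain Cb where "\<forall>f\<in>mixed_lebesgue q1. I f \<in> mixed_lebesgue q2 \<and> mixed_norm q2 (I f) \<le> ennreal Cb * mixed_norm q1 f"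
    using bounded unfolding bounded_operator_def by blast
  then have Cb: "mixed_norm q2 (I f) \<le> ennreal \<bar>Cb\<bar> * mixed_norm q1 f" if "f \<in> mixed_lebesgue q1" for f
    using that by (meson abs_ge_self ennreal_leI mult_right_mono order_trans zero_le)
  obtain Cf where Cf: "\<And>j f. f \<in> L1_supported_in (annulus j) \<Longrightarrow> AE x in lebesgue. 2 powr (real_of_int j + 1) \<le> norm x \<longrightarrow>
      norm (I f x) \<le> Cf * (LINT y|lebesgue. norm (f y)) * norm x powr (- (real CARD('n) - l))"
    using size_far by blast
  obtain Cn where Cn: "\<And>j f. f \<in> L1_supported_in (annulus j) \<Longrightarrow> AE x in lebesgue. norm x \<le> 2 powr (real_of_int j - 2) \<longrightarrow>
      norm (I f x) \<le> Cn * (LINT y|lebesgue. norm (f y)) * 2 powr (- (real_of_int j * (real CARD('n) - l)))"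
    using size_near by blast
  \<comment> \<open>The given constants may be negative, hence the absolute values. The powers of 2
    collect the offsets \<open>k - 1\<close>, \<open>k + 1\<close> and \<open>j + 1\<close> in the
    exponents of the two off-diagonal cases.\<close>
  define c where "c = \<bar>Cb\<bar> * E + \<bar>Cf\<bar> * 2 powr (2 * (A + B)) + \<bar>Cn\<bar> * 2 powr (A + B)"
  have c: "0 \<le> c" by (simp add: c_def E_def)
  have piece: "mixed_norm q2 (restr (annulus k) (I (restr (annulus j) f)))
      \<le> ennreal (c * w k j) * mixed_norm q1 (restr (annulus j) f)"
    if f: "f \<in> herz_morrey \<alpha> lam p1 q1" for f k j
  proof -
    define g where "g = restr (annulus j) f"
    define a where "a = mixed_norm q1 g"
    define N where "N = (LINT y|lebesgue. norm (g y))"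
    have gL: "g \<in> mixed_lebesgue q1"
      using f q1' by (auto simp: g_def herz_morrey_def intro: restr_annulus_in_mixed_lebesgue)
    have g1: "g \<in> L1_supported_in (annulus j)"
      and N: "ennreal N \<le> ennreal (2 powr (real_of_int (j + 1) * A)) * a"
      using restr_annulus_integrable[OF q1'(1), of j f] gL by (simp_all add: g_def a_def N_def A_def)
    have N0: "0 \<le> N" by (simp add: N_def)
    have w0: "0 \<le> w k j" by (simp add: w_def)
    \<comment> \<open>Common to both off-diagonal cases: a pointwise bound
      \<open>C * N * 2 powr s\<close> on the output annulus costs 2^((k+1)B) for the norm of its
      indicator and 2^((j+1)A) for the passage from \<open>N\<close> to \<open>a\<close>.\<close>
    have off: "mixed_norm q2 (restr (annulus k) (I g)) \<le> ennreal (c * w k j) * a"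
      if le: "AE x in lebesgue. x \<in> annulus k \<longrightarrow> norm (I g x) \<le> C * N * 2 powr s" and "0 \<le> C"
        and cw: "C * 2 powr (s + real_of_int (k + 1) * B + real_of_int (j + 1) * A) \<le> c * w k j" for C s
    proof -
      have "mixed_norm q2 (restr (annulus k) (I g)) \<le> ennreal (C * N * 2 powr s) * ennreal (2 powr (real_of_int (k + 1) * B))"
        unfolding mixed_norm_restr B_def
        by (rule emixed_norm_annulus_le[OF q2']) (use le in \<open>eventually_elim, simp add: ennreal_leI\<close>)
      also have "\<dots> = ennreal (C * 2 powr s * 2 powr (real_of_int (k + 1) * B)) * ennreal N"
        using \<open>0 \<le> C\<close> N0 by (simp only: ennreal_mult powr_ge_zero mult_nonneg_nonneg mult_ac)
      also have "\<dots> \<le> ennreal (C * 2 powr s * 2 powr (real_of_int (k + 1) * B)) *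
          (ennreal (2 powr (real_of_int (j + 1) * A)) * a)"
        by (intro mult_left_mono N) simp
      also have "\<dots> = ennreal (C * 2 powr (s + real_of_int (k + 1) * B + real_of_int (j + 1) * A)) * a"
        using \<open>0 \<le> C\<close> ennreal_mult[of "C * 2 powr s * 2 powr (real_of_int (k + 1) * B)" "2 powr (real_of_int (j + 1) * A)"]
        by (simp only: powr_add mult.assoc powr_ge_zero mult_nonneg_nonneg)
      also have "\<dots> \<le> ennreal (c * w k j) * a"
        using cw by (intro mult_right_mono ennreal_leI) auto
      finally show ?thesis .
    qed
    \<comment> \<open>A gap of two is what the size conditions need: points of the
      \<open>k\<close>-th annulus satisfy |x| > 2^(k-1) \<ge> 2^(j+1) in the first case and |x|
      \<le> 2^k \<le> 2^(j-2) in the second.\<close>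
    consider "j + 2 \<le> k" | "k + 2 \<le> j" | "\<bar>k - j\<bar> \<le> 1" by linarith
    then have "mixed_norm q2 (restr (annulus k) (I g)) \<le> ennreal (c * w k j) * a"
    proof cases
      case 1
      show ?thesis
      proof (rule off[where C="\<bar>Cf\<bar>" and s="- (real_of_int (k - 1) * (A + B))"])
        show "AE x in lebesgue. x \<in> annulus k \<longrightarrow> norm (I g x) \<le> \<bar>Cf\<bar> * N * 2 powr (- (real_of_int (k - 1) * (A + B)))"
          using Cf[OF g1]
        proof eventually_elim
          fix x assume le: "2 powr (real_of_int j + 1) \<le> norm x \<longrightarrow>
              norm (I g x) \<le> Cf * (LINT y|lebesgue. norm (g y)) * norm x powr (- (real CARD('n) - l))"
          show "x \<in> annulus k \<longrightarrow> norm (I g x) \<le> \<bar>Cf\<bar> * N * 2 powr (- (real_of_int (k - 1) * (A + B)))"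
          proof
            assume "x \<in> annulus k"
            then have x: "2 powr real_of_int (k - 1) < norm x" by (simp add: mem_annulus)
            have "(2::real) powr (real_of_int j + 1) \<le> 2 powr real_of_int (k - 1)"
              using 1 by (intro powr_mono) auto
            with le x have "norm (I g x) \<le> Cf * N * norm x powr (- (A + B))"
              by (simp add: AB N_def)
            also have "\<dots> \<le> \<bar>Cf\<bar> * N * norm x powr (- (A + B))"
              using N0 by (intro mult_right_mono) auto
            also have "\<dots> \<le> \<bar>Cf\<bar> * N * (2 powr real_of_int (k - 1)) powr (- (A + B))"
              using x AB_pos N0 by (intro mult_left_mono powr_mono2') auto
            finally show "norm (I g x) \<le> \<bar>Cf\<bar> * N * 2 powr (- (real_of_int (k - 1) * (A + B)))"
              by (simp only: powr_powr mult_minus_right)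
          qed
        qed
        have "- (real_of_int (k - 1) * (A + B)) + real_of_int (k + 1) * B + real_of_int (j + 1) * A
            = 2 * (A + B) + - (real_of_int (k - j) * A)"
          by (simp add: algebra_simps)
        then have "\<bar>Cf\<bar> * 2 powr (- (real_of_int (k - 1) * (A + B)) + real_of_int (k + 1) * B + real_of_int (j + 1) * A)
            = \<bar>Cf\<bar> * 2 powr (2 * (A + B)) * 2 powr (- (real_of_int (k - j) * A))"
          by (simp only: powr_add mult.assoc)
        also have "\<dots> \<le> c * w k j"
          using 1 by (intro mult_mono w_far) (auto simp: c_def E_def)
        finally show "\<bar>Cf\<bar> * 2 powr (- (real_of_int (k - 1) * (A + B)) + real_of_int (k + 1) * B + real_of_int (j + 1) * A) \<le> c * w k j" .
      qed simp
    next
      case 2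
      show ?thesis
      proof (rule off[where C="\<bar>Cn\<bar>" and s="- (real_of_int j * (A + B))"])
        show "AE x in lebesgue. x \<in> annulus k \<longrightarrow> norm (I g x) \<le> \<bar>Cn\<bar> * N * 2 powr (- (real_of_int j * (A + B)))"
          using Cn[OF g1]
        proof eventually_elim
          fix x assume le: "norm x \<le> 2 powr (real_of_int j - 2) \<longrightarrow>
              norm (I g x) \<le> Cn * (LINT y|lebesgue. norm (g y)) * 2 powr (- (real_of_int j * (real CARD('n) - l)))"
          show "x \<in> annulus k \<longrightarrow> norm (I g x) \<le> \<bar>Cn\<bar> * N * 2 powr (- (real_of_int j * (A + B)))"
          proof
            assume "x \<in> annulus k"
            then have x: "norm x \<le> 2 powr real_of_int k" by (simp add: mem_annulus)
            have "(2::real) powr real_of_int k \<le> 2 powr (real_of_int j - 2)"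
              using 2 by (intro powr_mono) auto
            with le x have "norm (I g x) \<le> Cn * N * 2 powr (- (real_of_int j * (A + B)))"
              by (simp add: AB N_def)
            also have "\<dots> \<le> \<bar>Cn\<bar> * N * 2 powr (- (real_of_int j * (A + B)))"
              using N0 by (intro mult_right_mono) auto
            finally show "norm (I g x) \<le> \<bar>Cn\<bar> * N * 2 powr (- (real_of_int j * (A + B)))" .
          qed
        qed
        have "- (real_of_int j * (A + B)) + real_of_int (k + 1) * B + real_of_int (j + 1) * A
            = (A + B) + real_of_int (k - j) * B"
          by (simp add: algebra_simps)
        then have "\<bar>Cn\<bar> * 2 powr (- (real_of_int j * (A + B)) + real_of_int (k + 1) * B + real_of_int (j + 1) * A)
            = \<bar>Cn\<bar> * 2 powr (A + B) * 2 powr (real_of_int (k - j) * B)"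
          by (simp only: powr_add mult.assoc)
        also have "\<dots> \<le> c * w k j"
          using 2 by (intro mult_mono w_near) (auto simp: c_def E_def)
        finally show "\<bar>Cn\<bar> * 2 powr (- (real_of_int j * (A + B)) + real_of_int (k + 1) * B + real_of_int (j + 1) * A) \<le> c * w k j" .
      qed simp
    next
      case 3
      have "mixed_norm q2 (restr (annulus k) (I g)) \<le> mixed_norm q2 (I g)"
        unfolding mixed_norm_eq_emixed_norm
        by (rule emixed_norm_mono_AE[OF q2'], intro AE_I2) (simp add: restr_def split: split_indicator)
      also have "\<dots> \<le> ennreal \<bar>Cb\<bar> * a" unfolding a_def using gL by (rule Cb)
      also have "\<dots> \<le> ennreal (c * w k j) * a"
      proof (intro mult_right_mono ennreal_leI)
        have "\<bar>Cb\<bar> \<le> \<bar>Cb\<bar> * (E * w k j)"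
          using mult_left_mono[OF w_local[OF 3], of "\<bar>Cb\<bar>"] by simp
        also have "\<dots> \<le> c * w k j"
          unfolding mult.assoc[symmetric] by (intro mult_right_mono w0) (simp add: c_def)
        finally show "\<bar>Cb\<bar> \<le> c * w k j" .
      qed simp
      finally show ?thesis .
    qed
    then show ?thesis by (simp add: g_def a_def)
  qed
  obtain C where C: "0 \<le> C" "\<forall>u v. (\<forall>k. u k \<le> ennreal c * (\<integral>\<^sup>+ j.
      ennreal (2 powr (- \<delta> * \<bar>real_of_int (k - j)\<bar>)) * (ennreal (2 powr (real_of_int (k - j) * lam)) * v j)
      \<partial>count_space UNIV)) \<longrightarrow> morrey_norm lam p1 u \<le> ennreal C * morrey_norm lam p1 v"
    using morrey_norm_convolution[OF p(1) lambda \<delta>(1) c] .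
  have "I f \<in> herz_morrey \<alpha> lam p2 q2 \<and>
      herz_morrey_norm \<alpha> lam p2 q2 (I f) \<le> ennreal C * herz_morrey_norm \<alpha> lam p1 q1 f"
    if f: "f \<in> herz_morrey \<alpha> lam p1 q1" for f
  proof -
    have gL: "restr (annulus j) f \<in> mixed_lebesgue q1" for j
      using f q1' by (auto simp: herz_morrey_def intro: restr_annulus_in_mixed_lebesgue)
    have norm_le: "ennreal (2 powr (real_of_int k * \<alpha>)) * mixed_norm q2 (restr (annulus k) (I f)) \<le> ennreal c * (\<integral>\<^sup>+ j.
        ennreal (2 powr (- \<delta> * \<bar>real_of_int (k - j)\<bar>)) * (ennreal (2 powr (real_of_int (k - j) * lam)) *
        (ennreal (2 powr (real_of_int j * \<alpha>)) * mixed_norm q1 (restr (annulus j) f))) \<partial>count_space UNIV)" for k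
    proof -
      have pw: "2 powr (real_of_int k * \<alpha>) * (c * w k j) =
          c * (2 powr (- \<delta> * \<bar>real_of_int (k - j)\<bar>) * (2 powr (real_of_int (k - j) * lam) * 2 powr (real_of_int j * \<alpha>)))" for j
      proof -
        have "real_of_int k * \<alpha> + real_of_int (k - j) * (lam - \<alpha>) = real_of_int (k - j) * lam + real_of_int j * \<alpha>"
          by (simp add: algebra_simps)
        then have "2 powr (real_of_int k * \<alpha>) * 2 powr (real_of_int (k - j) * (lam - \<alpha>))
            = 2 powr (real_of_int (k - j) * lam) * 2 powr (real_of_int j * \<alpha>)"
          by (simp only: powr_add[symmetric])
        then show ?thesis by (simp add: w_def)
      qed
      have "mixed_norm q2 (restr (annulus k) (I f)) \<le>
          (\<integral>\<^sup>+ j. mixed_norm q2 (restr (annulus k) (I (restr (annulus j) f))) \<partial>count_space UNIV)"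
        using domain(1) gL by (intro mixed_norm_annulus_le_sum q2 dyadic f sublinear_operator_on_measurable[OF sublinear]) auto
      also have "\<dots> \<le> (\<integral>\<^sup>+ j. ennreal (c * w k j) * mixed_norm q1 (restr (annulus j) f) \<partial>count_space UNIV)"
        by (intro nn_integral_mono piece f)
      finally have "ennreal (2 powr (real_of_int k * \<alpha>)) * mixed_norm q2 (restr (annulus k) (I f)) \<le>
          ennreal (2 powr (real_of_int k * \<alpha>)) * (\<integral>\<^sup>+ j. ennreal (c * w k j) * mixed_norm q1 (restr (annulus j) f) \<partial>count_space UNIV)"
        by (rule mult_left_mono) simp
      also have "\<dots> = (\<integral>\<^sup>+ j. ennreal (2 powr (real_of_int k * \<alpha>) * (c * w k j)) * mixed_norm q1 (restr (annulus j) f) \<partial>count_space UNIV)"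
        by (subst nn_integral_cmult[symmetric]) (simp_all add: ennreal_mult' mult.assoc)
      also have "\<dots> = (\<integral>\<^sup>+ j. ennreal c * (
        ennreal (2 powr (- \<delta> * \<bar>real_of_int (k - j)\<bar>)) * (ennreal (2 powr (real_of_int (k - j) * lam)) *
        (ennreal (2 powr (real_of_int j * \<alpha>)) * mixed_norm q1 (restr (annulus j) f)))) \<partial>count_space UNIV)"
        unfolding pw using c by (simp only: ennreal_mult mult.assoc mult_nonneg_nonneg powr_ge_zero)
      finally show ?thesis by (subst (asm) nn_integral_cmult) simp_all
    qed
    have "herz_morrey_norm \<alpha> lam p2 q2 (I f) \<le> herz_morrey_norm \<alpha> lam p1 q2 (I f)"
      unfolding herz_morrey_norm_eq using p by (rule morrey_norm_antimono)
    also have "\<dots> \<le> ennreal C * herz_morrey_norm \<alpha> lam p1 q1 f"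
      unfolding herz_morrey_norm_eq by (rule C(2)[rule_format, OF norm_le])
    finally have le: "herz_morrey_norm \<alpha> lam p2 q2 (I f) \<le> ennreal C * herz_morrey_norm \<alpha> lam p1 q1 f" .
    also have "\<dots> < \<infinity>" using f by (simp add: herz_morrey_def ennreal_mult_less_top)
    finally have fin: "herz_morrey_norm \<alpha> lam p2 q2 (I f) < \<infinity>" .
    have "I f \<in> mixed_lebesgue_loc_punctured q2"
    proof (rule mixed_lebesgue_loc_puncturedI[OF q2])
      show "I f \<in> borel_measurable lebesgue"
        using sublinear_operator_on_measurable[OF sublinear] domain(3) f by blast
      show "mixed_norm q2 (restr (annulus k) (I f)) < \<infinity>" for k
        using fin p by (intro herz_morrey_norm_finite_imp[of p2]) auto
    qed
    with fin le show ?thesis by (simp add: herz_morrey_def)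
  qed
  then show ?thesis unfolding bounded_operator_def by blast
qed

end
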